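(* Let $A$ be a unital complex Banach algebra, and let $\Delta: A\to\mathbb{C}$ be a mapping satisfying the following properties: (a) $\Delta$ is 1-homogeneous, i.e. $\Delta(\lambda x)=\lambda\Delta(x)$ for every $x\in A$ and $\lambda\in\mathbb{C}$; (b) $\Delta(x)-\Delta(y)\in\mathbb{T}\,\sigma(x-y)$ for every $x,y\in A$. Then $\Delta$ is linear, and there exists $\lambda_0\in\mathbb{T}$ such that $\lambda_0\Delta$ is multiplicative.
   Context: A complex Banach algebra is an associative algebra over $\mathbb{C}$ which is also a Banach space satisfying $\|xy\|\le\|x\|\,\|y\|$ for all $x,y$; it is not assumed commutative. The mapping $\Delta$ is not assumed linear or continuous. $\mathbb{T}=\{\lambda\in\mathbb{C}:|\lambda|=1\}$, $\sigma(a)$ denotes the spectrum of $a$ in $A$, and $\mathbb{T}\,\sigma(a)=\{\lambda\mu:\lambda\in\mathbb{T},\ \mu\in\sigma(a)\}$. *)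

theory Defs
  imports "HOL-Analysis.Analysis"
begin

text \<open>
  The norm of the unit is not required to be 1, which is why the class is built on
  \<^class>\<open>real_normed_algebra\<close> and \<^class>\<open>real_algebra_1\<close> rather than on
  \<^class>\<open>real_normed_algebra_1\<close>.
\<close>

class complex_banach_algebra = real_algebra_1 + real_normed_algebra + banach +
  fixes scaleC :: "complex \<Rightarrow> 'a \<Rightarrow> 'a"  (infixr \<open>*\<^sub>C\<close> 75)
  assumes scaleC_add_right: "c *\<^sub>C (x + y) = c *\<^sub>C x + c *\<^sub>C y"
    and scaleC_add_left: "(c + d) *\<^sub>C x = c *\<^sub>C x + d *\<^sub>C x"
    and scaleC_scaleC: "c *\<^sub>C (d *\<^sub>C x) = (c * d) *\<^sub>C x"
    and scaleC_one: "1 *\<^sub>C x = x"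
    and scaleC_of_real: "complex_of_real r *\<^sub>C x = r *\<^sub>R x"
    and mult_scaleC_left: "(c *\<^sub>C x) * y = c *\<^sub>C (x * y)"
    and mult_scaleC_right: "x * (c *\<^sub>C y) = c *\<^sub>C (x * y)"
    and norm_scaleC: "norm (c *\<^sub>C x) = cmod c * norm x"

lemma vector_space_scaleC:
  "vector_space (scaleC :: complex \<Rightarrow> 'a \<Rightarrow> 'a::complex_banach_algebra)"
  by unfold_locales
    (simp_all add: scaleC_add_right scaleC_add_left scaleC_scaleC scaleC_one)

instantiation complex :: complex_banach_algebra
begin

definition scaleC_complex :: "complex \<Rightarrow> complex \<Rightarrow> complex"
  where "scaleC_complex c x = c * x"

instance
  by standard (simp_all add: scaleC_complex_def algebra_simps norm_mult scaleR_conv_of_real)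

end

definition invertible_elem :: "'a::complex_banach_algebra \<Rightarrow> bool"
  where "invertible_elem a \<longleftrightarrow> (\<exists>b. a * b = 1 \<and> b * a = 1)"

definition spectrum :: "'a::complex_banach_algebra \<Rightarrow> complex set"
  where "spectrum a = {\<mu>. \<not> invertible_elem (a - \<mu> *\<^sub>C 1)}"

definition unit_circle :: "complex set"
  where "unit_circle = {\<zeta>. cmod \<zeta> = 1}"

definition circle_spectrum :: "'a::complex_banach_algebra \<Rightarrow> complex set"
  where "circle_spectrum a = {\<zeta> * \<mu> | \<zeta> \<mu>. \<zeta> \<in> unit_circle \<and> \<mu> \<in> spectrum a}"

end

theory Submission
  imports Defs "HOL-Complex_Analysis.Complex_Analysis"
begin

text \<open>
  After rescaling so that \<open>\<Delta> 1 = 1\<close>, the map \<open>\<lambda> \<mapsto> \<Delta> (x + \<lambda> 1)\<close> is an isometry of the plane which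
  stays close to the identity, hence \<open>\<Delta> (x + \<lambda> 1) = \<Delta> x + \<lambda>\<close>, and this removes the circle:
  \<open>\<Delta> x - \<Delta> y\<close> lies in the spectrum of \<open>x - y\<close>.

  The maps with this property form a compact set, invariant under \<open>f \<mapsto> f (z + \<cdot>) - f z\<close> and
  \<open>f \<mapsto> n f (\<cdot> / n)\<close>. This replaces the almost everywhere differentiability of Lipschitz maps in the
  classical proof of the Kowalski-Slodkowski theorem. A contour integral over a parallelogram is the
  average of its rescaled copies over the cells of a subdivision, so a maximiser of it over the
  compact set is maximal on all cells. Comparing nearby parallelograms (the area beats the perimeter)
  and passing to a limit gives maps on which the integral is maximal everywhere, and a minimal
  invariant family of these consists of real-linear maps. So the maximum of the integral is attained
  at a real-linear map with values in the spectrum. Such a map is complex-linear, and so the integral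
  vanishes identically. By a Morera argument \<open>\<Delta>\<close> is then entire and Lipschitz, hence affine, on every
  complex line, and homogeneity makes it linear. Multiplicativity is the Gleason-Kahane-Zelazko
  theorem.
\<close>

text \<open>Archimedean closing step of several later arguments, each of which bounds
  \<open>n\<close> times a modulus by a constant independent of \<open>n\<close>.\<close>

lemma nonneg_eq_0_if_multiples_bounded:
  fixes c :: real
  assumes "0 \<le> c" and bound: "\<And>n. real (Suc n) * c \<le> B"
  shows "c = 0"
proof (rule ccontr)
  assume "c \<noteq> 0"
  then have "c > 0" using assms(1) by simp
  then obtain n where "B < real n * c" using reals_Archimedean3 by blast
  also have "\<dots> \<le> real (Suc n) * c" using assms(1) by (intro mult_right_mono) auto
  finally show False using bound[of n] by simp
qed

subsection \<open>Averages over parallelograms\<close>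

lemma integral_eq_mean_of_cells:
  fixes \<phi> :: "real \<Rightarrow> complex"
  assumes cont: "continuous_on UNIV \<phi>" and "n > 0"
  shows "integral {0..1} \<phi> = (\<Sum>k<n. integral {0..1} (\<lambda>s. \<phi> ((real k + s) / real n))) / of_nat n"
proof -
  have int: "\<phi> integrable_on {a..b}" for a b
    by (intro integrable_continuous_interval continuous_on_subset [OF cont]) auto
  have cell: "integral {0..1} (\<lambda>s. \<phi> ((real k + s) / real n)) 
      = of_nat n * integral {real k / real n..real (Suc k) / real n} \<phi>" for k
  proof -
    have "((\<lambda>s. \<phi> ((1 / real n) *\<^sub>R s + real k / real n)) has_integral
        integral {real k / real n..real (Suc k) / real n} \<phi> /\<^sub>R (1 / real n)) {0..1}"
      using has_integral_affinity'[OF integrable_integral[OF int[of "real k / real n" "real (Suc k) / real n"],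
            folded cbox_interval], of "1 / real n" "real k / real n"] \<open>n > 0\<close>
      by (simp add: diff_divide_distrib[symmetric])
    then show ?thesis
      using \<open>n > 0\<close> by (simp add: integral_unique add_divide_distrib scaleR_conv_of_real add.commute)
  qed
  have "integral {0..real m / real n} \<phi> = (\<Sum>k<m. integral {real k / real n..real (Suc k) / real n} \<phi>)" for m
  proof (induction m)
    case (Suc m)
    have "integral {0..real m / real n} \<phi> + integral {real m / real n..real (Suc m) / real n} \<phi>
        = integral {0..real (Suc m) / real n} \<phi>"
      by (intro Henstock_Kurzweil_Integration.integral_combine int) (auto simp: divide_right_mono)
    with Suc show ?case by simp
  qed auto
  from this[of n] show ?thesis
    using \<open>n > 0\<close> by (simp add: cell sum_distrib_left[symmetric])
qed

definition shift :: "'a::real_normed_vector \<Rightarrow> ('a \<Rightarrow> complex) \<Rightarrow> 'a \<Rightarrow> complex"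
  where "shift z f = (\<lambda>x. f (z + x) - f z)"

text \<open>A difference quotient with step \<open>1 / n\<close>:
  \<open>magnify n (shift z f)\<close> zooms in on \<open>f\<close> at \<open>z\<close>. The factor
  \<open>n\<close> preserves Lipschitz constants and fixes real-linear maps.\<close>

definition magnify :: "nat \<Rightarrow> ('a::real_normed_vector \<Rightarrow> complex) \<Rightarrow> 'a \<Rightarrow> complex"
  where "magnify n f = (\<lambda>x. of_nat n * f (x /\<^sub>R real n))"

text \<open>On a complex line, with \<open>u = c v\<close> and \<open>w = d v\<close>,
  \<open>d\<close> times this is the difference of the contour integrals along two opposite sides of
  the parallelogram spanned by \<open>c\<close> and \<open>d\<close>.\<close>

definition slab :: "'a::real_normed_vector \<Rightarrow> 'a \<Rightarrow> ('a \<Rightarrow> complex) \<Rightarrow> complex"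
  where "slab u w f = integral {0..1} (\<lambda>s. f (u + s *\<^sub>R w) - f (s *\<^sub>R w))"

text \<open>Cells adjacent in the direction of \<open>u\<close> share a side, so the sum telescopes
  in \<open>j\<close>. In the direction of \<open>w\<close> the cells cut the unit interval into
  \<open>n\<close> pieces. The factor \<open>n\<close> in \<open>magnify\<close> makes the result an
  honest average over the \<open>n^2\<close> cells.\<close>

lemma slab_subdivide:
  fixes f :: "'a::real_normed_vector \<Rightarrow> complex"
  assumes cont: "continuous_on UNIV f" and "n > 0"
  shows "slab u w f = (\<Sum>j<n. \<Sum>k<n. slab u w (magnify n (shift ((real j *\<^sub>R u + real k *\<^sub>R w) /\<^sub>R real n) f))) / (of_nat n)\<^sup>2"
proof -
  define \<phi> where "\<phi> = (\<lambda>s. f (u + s *\<^sub>R w) - f (s *\<^sub>R w))"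
  \<comment> \<open>Values of \<open>f\<close> along the side of cell \<open>(j, k)\<close> parallel
    to \<open>w\<close>; the opposite side is \<open>g (Suc j) k\<close>.\<close>
  define g where "g j k s = f ((real j / real n) *\<^sub>R u + ((real k + s) / real n) *\<^sub>R w)" for j k s
  have cf: "continuous_on S (\<lambda>s. f (h s))" if "continuous_on S h" for h :: "real \<Rightarrow> 'a" and S
    using continuous_on_compose2[OF cont that] by simp
  have cg: "continuous_on S (g j k)" for S j k
    unfolding g_def by (intro cf continuous_intros) (use \<open>n>0\<close> in auto)
  have c\<phi>: "continuous_on UNIV \<phi>" unfolding \<phi>_def by (intro continuous_intros cf)
  have 1: "slab u w (magnify n (shift ((real j *\<^sub>R u + real k *\<^sub>R w) /\<^sub>R real n) f))
     = of_nat n * (integral {0..1} (g (Suc j) k) - integral {0..1} (g j k))" for j k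
  proof -
    have "slab u w (magnify n (shift ((real j *\<^sub>R u + real k *\<^sub>R w) /\<^sub>R real n) f))
       = integral {0..1} (\<lambda>s. of_nat n * (g (Suc j) k s - g j k s))"
      unfolding slab_def magnify_def shift_def g_def
      by (intro arg_cong[where f="integral {0..1}"] ext)
         (simp add: algebra_simps add_divide_distrib divide_inverse_commute)
    also have "\<dots> = of_nat n * integral {0..1} (\<lambda>s. g (Suc j) k s - g j k s)" by simp
    also have "integral {0..1} (\<lambda>s. g (Suc j) k s - g j k s) = integral {0..1} (g (Suc j) k) - integral {0..1} (g j k)"
      by (intro integral_diff integrable_continuous_interval cg)
    finally show ?thesis .
  qed
  have "(\<Sum>j<n. \<Sum>k<n. slab u w (magnify n (shift ((real j *\<^sub>R u + real k *\<^sub>R w) /\<^sub>R real n) f)))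
     = (\<Sum>k<n. \<Sum>j<n. of_nat n * (integral {0..1} (g (Suc j) k) - integral {0..1} (g j k)))"
    by (subst sum.swap) (simp add: 1)
  also have "\<dots> = (\<Sum>k<n. of_nat n * (integral {0..1} (g n k) - integral {0..1} (g 0 k)))"
    using sum_lessThan_telescope[of "\<lambda>j. integral {0..1} (g j k)" n for k]
    by (simp add: sum_distrib_left[symmetric])
  also have "\<dots> = (\<Sum>k<n. of_nat n * integral {0..1} (\<lambda>s. \<phi> ((real k + s) / real n)))"
  proof (intro sum.cong refl arg_cong2[where f="(*)"])
    fix k
    have "integral {0..1} (g n k) - integral {0..1} (g 0 k) = integral {0..1} (\<lambda>s. g n k s - g 0 k s)"
      by (intro integral_diff[symmetric] integrable_continuous_interval cg)
    then show "integral {0..1} (g n k) - integral {0..1} (g 0 k) = integral {0..1} (\<lambda>s. \<phi> ((real k + s) / real n))"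
      using \<open>n > 0\<close> by (simp add: g_def \<phi>_def)
  qed
  also have "\<dots> = of_nat n * (of_nat n * slab u w f)"
    using integral_eq_mean_of_cells[OF c\<phi> \<open>n > 0\<close>] \<open>n > 0\<close>
    by (simp add: sum_distrib_left[symmetric] slab_def \<phi>_def)
  finally show ?thesis using \<open>n > 0\<close> by (simp add: power2_eq_square)
qed

text \<open>Moving the parallelogram by \<open>y\<close> changes \<open>f\<close> by at most
  \<open>norm y\<close> on each of the two sides, and the constants \<open>f y\<close> cancel. The
  bound does not depend on the size of the parallelogram.\<close>

lemma slab_shift_diff:
  assumes "1-lipschitz_on UNIV f"
  shows "cmod (slab u w (shift y f) - slab u w f) \<le> 2 * norm y"
proof -
  have cont: "continuous_on UNIV f" using assms lipschitz_on_continuous_on by blast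
  have cf: "continuous_on S (\<lambda>s. f (h s))" if "continuous_on S h" for h :: "real \<Rightarrow> 'a" and S
    using continuous_on_compose2[OF cont that] by simp
  have lip: "cmod (f x - f x') \<le> norm (x - x')" for x x'
    using assms by (auto simp: lipschitz_on_def dist_norm)
  have "slab u w (shift y f) - slab u w f = integral {0..1} (\<lambda>s.
      ((f (y + (u + s *\<^sub>R w)) - f y) - (f (y + s *\<^sub>R w) - f y)) - (f (u + s *\<^sub>R w) - f (s *\<^sub>R w)))"
    unfolding slab_def shift_def
    by (intro integral_diff[symmetric] integrable_continuous_interval continuous_intros cf)
  also have "cmod \<dots> \<le> (2 * norm y) * (1 - 0)"
  proof (intro integral_bound continuous_intros cf)
    fix s :: real
    have "cmod (((f (y + (u + s *\<^sub>R w)) - f y) - (f (y + s *\<^sub>R w) - f y)) - (f (u + s *\<^sub>R w) - f (s *\<^sub>R w)))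
       = cmod ((f (y + (u + s *\<^sub>R w)) - f (u + s *\<^sub>R w)) - (f (y + s *\<^sub>R w) - f (s *\<^sub>R w)))"
      by (simp add: algebra_simps)
    also have "\<dots> \<le> norm y + norm y"
      using lip[of "y + (u + s *\<^sub>R w)" "u + s *\<^sub>R w"] lip[of "y + s *\<^sub>R w" "s *\<^sub>R w"]
      by (intro order_trans[OF norm_triangle_ineq4 add_mono]) simp_all
    finally show "cmod (((f (y + (u + s *\<^sub>R w)) - f y) - (f (y + s *\<^sub>R w) - f y)) - (f (u + s *\<^sub>R w) - f (s *\<^sub>R w))) \<le> 2 * norm y"
      by simp
  qed auto
  finally show ?thesis by simp
qed

text \<open>The topology is that of pointwise convergence, for which integration is not continuous
  in general. On 1-Lipschitz maps, however, Riemann sums converge uniformly, and each of them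
  depends on finitely many values of \<open>f\<close>.\<close>

lemma continuous_on_slab:
  "continuous_on {f. 1-lipschitz_on UNIV f} (slab u w)"
proof (rule uniform_limit_theorem[where F=sequentially])
  define R where "R m f = (\<Sum>k<m. f (u + (real k / real m) *\<^sub>R w) - f ((real k / real m) *\<^sub>R w)) / of_nat m"
    for m and f :: "'a \<Rightarrow> complex"
  show "\<forall>\<^sub>F m in sequentially. continuous_on {f. 1-lipschitz_on UNIV f} (R m)"
    using eventually_gt_at_top[of 0] unfolding R_def
    by eventually_elim
      (intro continuous_intros continuous_on_product_then_coordinatewise[OF continuous_on_id]; simp)
  show "uniform_limit {f. 1-lipschitz_on UNIV f} R (slab u w) sequentially"
  proof (rule uniform_limitI)
    fix e :: real assume "e > 0"
    obtain N :: nat where N: "2 * norm w / e < real N" using reals_Archimedean2 by blast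
    show "\<forall>\<^sub>F m in sequentially. \<forall>f\<in>{f. 1-lipschitz_on UNIV f}. dist (R m f) (slab u w f) < e"
      using eventually_ge_at_top[of "Suc N"]
    proof eventually_elim
      case (elim m)
      then have m: "m > 0" by simp
      show ?case
      proof safe
        fix f :: "'a \<Rightarrow> complex" assume f: "1-lipschitz_on UNIV f"
        have cont: "continuous_on UNIV f" using f lipschitz_on_continuous_on by blast
        have cf: "continuous_on S (\<lambda>s. f (h s))" if "continuous_on S h" for h :: "real \<Rightarrow> 'a" and S
          using continuous_on_compose2[OF cont that] by simp
        have lip: "cmod (f x - f x') \<le> norm (x - x')" for x x'
          using f by (auto simp: lipschitz_on_def dist_norm)
        define \<phi> where "\<phi> = (\<lambda>s. f (u + s *\<^sub>R w) - f (s *\<^sub>R w))"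
        have c\<phi>: "continuous_on UNIV \<phi>" unfolding \<phi>_def by (intro continuous_intros cf)
        have c\<phi>': "continuous_on S (\<lambda>s. \<phi> (h s))" if "continuous_on S h" for h :: "real \<Rightarrow> real" and S
          using continuous_on_compose2[OF c\<phi> that] by simp
        have lip\<phi>: "cmod (\<phi> s - \<phi> t) \<le> 2 * (\<bar>s - t\<bar> * norm w)" for s t
        proof -
          have "cmod (\<phi> s - \<phi> t) = cmod ((f (u + s *\<^sub>R w) - f (u + t *\<^sub>R w)) - (f (s *\<^sub>R w) - f (t *\<^sub>R w)))"
            by (simp add: \<phi>_def algebra_simps)
          also have "\<dots> \<le> norm ((s - t) *\<^sub>R w) + norm ((s - t) *\<^sub>R w)"
            using lip[of "u + s *\<^sub>R w" "u + t *\<^sub>R w"] lip[of "s *\<^sub>R w" "t *\<^sub>R w"]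
            by (intro order_trans[OF norm_triangle_ineq4 add_mono]) (simp_all flip: scaleR_left_diff_distrib)
          finally show ?thesis by (simp add: mult.commute)
        qed
        have "slab u w f - R m f = (\<Sum>k<m. integral {0..1} (\<lambda>s. \<phi> ((real k + s) / real m)) - \<phi> (real k / real m)) / of_nat m"
          using integral_eq_mean_of_cells[OF c\<phi> m] 
          by (simp add: slab_def R_def \<phi>_def sum_subtractf diff_divide_distrib)
        also have "cmod \<dots> \<le> (\<Sum>k<m. 2 * norm w / real m) / real m"
          unfolding norm_divide norm_of_nat
        proof (intro divide_right_mono sum_norm_le)
          fix k
          have "integral {0..1} (\<lambda>s. \<phi> ((real k + s) / real m)) - \<phi> (real k / real m)
             = integral {0..1} (\<lambda>s. \<phi> ((real k + s) / real m) - \<phi> (real k / real m))"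
            by (subst integral_diff) (use m in \<open>auto intro!: integrable_continuous_interval c\<phi>' continuous_intros\<close>)
          also have "cmod \<dots> \<le> (2 * norm w / real m) * (1 - 0)"
          proof (intro integral_bound continuous_intros c\<phi>')
            fix s :: real assume s: "s \<in> {0..1}"
            have "cmod (\<phi> ((real k + s) / real m) - \<phi> (real k / real m)) \<le> 2 * (\<bar>(real k + s) / real m - real k / real m\<bar> * norm w)"
              by (rule lip\<phi>)
            also have "(real k + s) / real m - real k / real m = s / real m" by (simp add: add_divide_distrib)
            also have "2 * (\<bar>s / real m\<bar> * norm w) \<le> 2 * ((1 / real m) * norm w)"
              using s by (intro mult_left_mono mult_right_mono) (auto simp: divide_right_mono)
            finally show "cmod (\<phi> ((real k + s) / real m) - \<phi> (real k / real m)) \<le> 2 * norm w / real m" by simp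
          qed (use m in auto)
          finally show "cmod (integral {0..1} (\<lambda>s. \<phi> ((real k + s) / real m)) - \<phi> (real k / real m)) \<le> 2 * norm w / real m" by simp
        qed auto
        also have "\<dots> = 2 * norm w / real m" using m by simp
        also have "\<dots> < e"
        proof -
          have "2 * norm w / e < real m" using N elim by linarith
          then show ?thesis using \<open>e > 0\<close> m by (simp add: field_simps)
        qed
        finally show "dist (R m f) (slab u w f) < e" by (simp add: dist_norm norm_minus_commute)
      qed
    qed
  qed
qed auto

subsection \<open>Linear maps maximising an average\<close>

definition renormalizable :: "('a::real_normed_vector \<Rightarrow> complex) set \<Rightarrow> bool"
  where "renormalizable F \<longleftrightarrow> (\<forall>f\<in>F. (\<forall>z. shift z f \<in> F) \<and> (\<forall>n>0. magnify n f \<in> F))"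

definition pointed_lipschitz :: "('a::real_normed_vector \<Rightarrow> complex) set"
  where "pointed_lipschitz = {f. f 0 = 0 \<and> 1-lipschitz_on UNIV f}"

lemma pointed_lipschitzD:
  assumes "f \<in> pointed_lipschitz"
  shows "f 0 = 0" "1-lipschitz_on UNIV f" "cmod (f x - f y) \<le> norm (x - y)" "cmod (f x) \<le> norm x"
    "continuous_on UNIV f"
proof -
  show 0: "f 0 = 0" and 1: "1-lipschitz_on UNIV f"
    using assms by (auto simp: pointed_lipschitz_def)
  show *: "cmod (f x - f y) \<le> norm (x - y)" for x y
    using 1 by (auto simp: lipschitz_on_def dist_norm)
  show "cmod (f x) \<le> norm x" using *[of x 0] 0 by simp
  show "continuous_on UNIV f" using 1 lipschitz_on_continuous_on by blast
qed

lemma renormalizableD: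
  assumes "renormalizable F" "f \<in> F"
  shows "shift z f \<in> F" "n > 0 \<Longrightarrow> magnify n f \<in> F"
  using assms by (auto simp: renormalizable_def)

lemma shift_shift: "shift z (shift y f) = shift (y + z) f"
  by (auto simp: shift_def add.assoc)

lemma shift_0: "f 0 = 0 \<Longrightarrow> shift 0 f = f"
  by (auto simp: shift_def)

lemma shift_magnify:
  "n > 0 \<Longrightarrow> shift z (magnify n (shift p f)) = magnify n (shift p (shift (z /\<^sub>R real n) f))"
  by (rule ext) (simp add: shift_def magnify_def algebra_simps)

text \<open>Tychonoff: the set is closed in the product of the discs of radius
  \<open>norm x\<close>, since its conditions involve at most two coordinates each.\<close>

lemma compact_pointed_lipschitz: "compact (pointed_lipschitz :: ('a::real_normed_vector \<Rightarrow> complex) set)"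
proof -
  have "compactin (product_topology (\<lambda>i. euclidean) UNIV) (PiE (UNIV::'a set) (\<lambda>x. cball (0::complex) (norm x)))"
    by (simp add: compactin_PiE)
  then have c: "compact (PiE (UNIV::'a set) (\<lambda>x. cball (0::complex) (norm x)))"
    by (simp add: euclidean_product_topology)
  have eq: "(pointed_lipschitz :: ('a \<Rightarrow> complex) set) = {f. f 0 = 0} \<inter> (\<Inter>x. \<Inter>y. {f. dist (f x) (f y) \<le> dist x y})"
    by (auto simp: pointed_lipschitz_def lipschitz_on_def)
  have "closed (pointed_lipschitz :: ('a \<Rightarrow> complex) set)"
    unfolding eq
    by (intro closed_Int closed_INT ballI closed_Collect_eq closed_Collect_le continuous_intros
        continuous_on_product_coordinates)
  moreover have "pointed_lipschitz \<subseteq> PiE (UNIV::'a set) (\<lambda>x. cball (0::complex) (norm x))"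
    by (auto dest: pointed_lipschitzD)
  ultimately show ?thesis using c by (metis compact_Int_closed inf.absorb_iff2)
qed

text \<open>
  For \<open>u = c v\<close>, \<open>w = d v\<close>, \<open>\<alpha> = \<omega> d\<close>, \<open>\<beta> = - \<omega> c\<close> this is the real part of \<open>\<omega>\<close> times a contour integral
  over the boundary of a parallelogram in the complex line of \<open>v\<close>; for \<open>w = 0\<close>, \<open>\<beta> = 0\<close> it is the
  increment \<open>Re (\<alpha> (f u - f 0))\<close>.
\<close>

definition flux :: "complex \<Rightarrow> complex \<Rightarrow> 'a::real_normed_vector \<Rightarrow> 'a \<Rightarrow> ('a \<Rightarrow> complex) \<Rightarrow> real"
  where "flux \<alpha> \<beta> u w f = Re (\<alpha> * slab u w f + \<beta> * slab w u f)"

lemma flux_subdivide: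
  fixes f :: "'a::real_normed_vector \<Rightarrow> complex"
  assumes "continuous_on UNIV f" and "n > 0"
  shows "(\<Sum>j<n. \<Sum>k<n. flux \<alpha> \<beta> u w (magnify n (shift ((real j *\<^sub>R u + real k *\<^sub>R w) /\<^sub>R real n) f)))
    = (real n)\<^sup>2 * flux \<alpha> \<beta> u w f"
proof -
  define c where "c j k = magnify n (shift ((real j *\<^sub>R u + real k *\<^sub>R w) /\<^sub>R real n) f)" for j k
  have 1: "(\<Sum>j<n. \<Sum>k<n. slab u w (c j k)) = (of_nat n)\<^sup>2 * slab u w f"
    using slab_subdivide[OF assms, of u w] \<open>n > 0\<close> by (simp add: c_def)
  \<comment> \<open>Exchanging \<open>u\<close> and \<open>w\<close> transposes the grid of
    cells.\<close>
  have "(\<Sum>j<n. \<Sum>k<n. slab w u (c j k)) = (\<Sum>k<n. \<Sum>j<n. slab w u (c j k))"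
    by (rule sum.swap)
  also have "\<dots> = (of_nat n)\<^sup>2 * slab w u f"
    using slab_subdivide[OF assms, of w u] \<open>n > 0\<close> by (simp add: c_def add.commute)
  finally have 2: "(\<Sum>j<n. \<Sum>k<n. slab w u (c j k)) = (of_nat n)\<^sup>2 * slab w u f" .
  have "(\<Sum>j<n. \<Sum>k<n. flux \<alpha> \<beta> u w (c j k))
      = Re (\<alpha> * (\<Sum>j<n. \<Sum>k<n. slab u w (c j k)) + \<beta> * (\<Sum>j<n. \<Sum>k<n. slab w u (c j k)))"
    by (simp add: flux_def sum_distrib_left sum.distrib sum_subtractf)
  also have "\<dots> = Re (complex_of_real ((real n)\<^sup>2) * (\<alpha> * slab u w f + \<beta> * slab w u f))"
    unfolding 1 2 by (simp add: algebra_simps)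
  also have "\<dots> = (real n)\<^sup>2 * flux \<alpha> \<beta> u w f"
  proof -
    have "Re (complex_of_real r * z) = r * Re z" for r z by simp
    then show ?thesis by (simp only: flux_def)
  qed
  finally show ?thesis by (simp add: c_def)
qed

lemma flux_shift_diff:
  assumes "1-lipschitz_on UNIV f"
  shows "\<bar>flux \<alpha> \<beta> u w (shift y f) - flux \<alpha> \<beta> u w f\<bar> \<le> 2 * (cmod \<alpha> + cmod \<beta>) * norm y"
proof -
  have "flux \<alpha> \<beta> u w (shift y f) - flux \<alpha> \<beta> u w f
     = Re (\<alpha> * (slab u w (shift y f) - slab u w f) + \<beta> * (slab w u (shift y f) - slab w u f))"
    by (simp add: flux_def algebra_simps)
  also have "\<bar>\<dots>\<bar> \<le> cmod \<alpha> * (2 * norm y) + cmod \<beta> * (2 * norm y)"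
    by (rule order_trans[OF abs_Re_le_cmod], rule order_trans[OF norm_triangle_ineq])
       (unfold norm_mult, intro add_mono mult_left_mono slab_shift_diff assms norm_ge_zero)
  finally show ?thesis by (simp add: algebra_simps)
qed

lemma continuous_on_flux_shift:
  "continuous_on pointed_lipschitz (\<lambda>f. flux \<alpha> \<beta> u w (shift z f))"
proof -
  have "1-lipschitz_on UNIV (shift z f)" if "1-lipschitz_on UNIV f" for f :: "'a \<Rightarrow> complex"
  proof (rule lipschitz_onI)
    fix x y show "dist (shift z f x) (shift z f y) \<le> 1 * dist x y"
      using lipschitz_onD[OF that, of "z + x" "z + y"] by (simp add: shift_def dist_norm)
  qed simp
  then have "continuous_on pointed_lipschitz (\<lambda>f. slab u' w' (shift z f))" for u' w' :: 'a
    by (intro continuous_on_compose2[OF continuous_on_slab])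
       (auto simp: shift_def pointed_lipschitz_def intro!: continuous_on_coordinatewise_then_product
         continuous_intros continuous_on_product_then_coordinatewise[OF continuous_on_id])
  then show ?thesis unfolding flux_def by (intro continuous_intros)
qed

text \<open>By compactness some \<open>f1\<close> attains the maximum \<open>M\<close>, and its flux
  is the average over its cells. Cells on which finitely many translates are all nearly maximal
  exist for fine subdivisions, and compactness turns them into a map all of whose translates are
  maximal.\<close>

lemma exists_extremal_family:
  fixes F :: "('a::real_normed_vector \<Rightarrow> complex) set"
  assumes F: "closed F" "F \<noteq> {}" "renormalizable F" "F \<subseteq> pointed_lipschitz"
  obtains M G where "closed G" "G \<noteq> {}" "renormalizable G" "G \<subseteq> F"
    "\<And>f. f \<in> F \<Longrightarrow> flux \<alpha> \<beta> u w f \<le> M" "\<And>f. f \<in> G \<Longrightarrow> flux \<alpha> \<beta> u w f = M"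
proof -
  let ?q = "flux \<alpha> \<beta> u w"
  define C where "C = 2 * (cmod \<alpha> + cmod \<beta>)"
  have "compact F" using F compact_pointed_lipschitz by (metis compact_Int_closed inf.absorb_iff2)
  note FD = pointed_lipschitzD[OF subsetD[OF F(4)]]
  have cont: "continuous_on F (\<lambda>f. ?q (shift z f))" for z
    using continuous_on_flux_shift F(4) continuous_on_subset by blast
  have "continuous_on F ?q"
    using cont[of 0] by (rule continuous_on_eq) (simp add: shift_0 FD(1))
  then obtain f1 where f1: "f1 \<in> F" "\<And>f. f \<in> F \<Longrightarrow> ?q f \<le> ?q f1"
    using continuous_attains_sup[OF \<open>compact F\<close> F(2)] by blast
  define M where "M = ?q f1"
  have M: "?q f \<le> M" if "f \<in> F" for f using f1 that M_def by simp
  \<comment> \<open>Maximality is demanded of every translate so that \<open>G\<close> is invariant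
    under \<open>shift\<close>.\<close>
  define G where "G = {f \<in> F. \<forall>z. ?q (shift z f) = M}"
  have "closed G"
  proof -
    have "G = F \<inter> (\<Inter>z. F \<inter> (\<lambda>f. ?q (shift z f)) -` {M})" by (auto simp: G_def)
    moreover have "closed (F \<inter> (\<Inter>z. F \<inter> (\<lambda>f. ?q (shift z f)) -` {M}))"
      by (intro closed_Int closed_INT ballI F(1) continuous_closed_preimage cont) auto
    ultimately show ?thesis by simp
  qed
  moreover have "G \<noteq> {}"
  proof -
    \<comment> \<open>\<open>E (z, e)\<close> collects the maps whose translate by \<open>z\<close>
      is maximal up to \<open>e\<close>. A point common to all these closed sets lies in
      \<open>G\<close>, and the finite intersection property reduces this to finitely many
      pairs.\<close>
    define E where "E = (\<lambda>(z, e). F \<inter> (\<lambda>f. ?q (shift z f)) -` {M - e..})"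
    have "F \<inter> (\<Inter>i\<in>UNIV \<times> {0<..}. E i) \<noteq> {}"
    proof (rule compact_imp_fip_image[OF \<open>compact F\<close>])
      fix i :: "'a \<times> real" show "closed (E i)"
        unfolding E_def case_prod_unfold
        by (intro continuous_closed_preimage cont F(1) closed_atLeast)
    next
      fix I' :: "('a \<times> real) set" assume I': "finite I'" "I' \<subseteq> UNIV \<times> {0<..}"
      define Z where "Z = fst ` I'"
      \<comment> \<open>The element 1 gives the minimum a meaning when \<open>I'\<close> is
        empty.\<close>
      define e where "e = Min (insert 1 (snd ` I'))"
      have "finite Z" using I' by (simp add: Z_def)
      have "e > 0" using I' by (auto simp: e_def Min_gr_iff)
      define S where "S = (\<Sum>z\<in>Z. norm z)"
      obtain n0 :: nat where n0: "C * S / e < real n0" using reals_Archimedean2 by blast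
      define n where "n = Suc n0"
      have n: "n > 0" "C * S / real n < e"
      proof -
        have "C * S / e < real n" using n0 by (simp add: n_def)
        then show "C * S / real n < e" using \<open>e > 0\<close> by (simp add: n_def field_simps)
      qed (simp add: n_def)
      define c where "c j k = (\<lambda>f. magnify n (shift ((real j *\<^sub>R u + real k *\<^sub>R w) /\<^sub>R real n) f))" for j k
      have cF: "c j k f \<in> F" if "f \<in> F" for j k f
        using that F(3) n(1) by (auto simp: c_def intro!: renormalizableD)
      txt \<open>The defects of all \<open>n\<^sup>2\<close> cells add up to \<open>O(n)\<close> only, so some cell has a small defect.\<close>
      have "(\<Sum>j<n. \<Sum>k<n. \<Sum>z\<in>Z. M - ?q (shift z (c j k f1)))
          = (\<Sum>z\<in>Z. \<Sum>j<n. \<Sum>k<n. M - ?q (shift z (c j k f1)))"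
        by (simp add: sum.swap[of _ _ Z])
      also have "\<dots> = (\<Sum>z\<in>Z. (real n)\<^sup>2 * (M - ?q (shift (z /\<^sub>R real n) f1)))"
      proof (intro sum.cong refl)
        \<comment> \<open>Shifting every cell of \<open>f1\<close> by \<open>z\<close> yields the
          cells of \<open>f1\<close> shifted by \<open>z / n\<close>, so the sum is
          \<open>n^2\<close> times a single flux.\<close>
        fix z
        have "(\<Sum>j<n. \<Sum>k<n. ?q (shift z (c j k f1))) = (real n)\<^sup>2 * ?q (shift (z /\<^sub>R real n) f1)"
          unfolding c_def using n(1) 
          by (simp only: shift_magnify) (rule flux_subdivide, auto intro!: FD renormalizableD F(3) f1(1))
        then show "(\<Sum>j<n. \<Sum>k<n. M - ?q (shift z (c j k f1))) = (real n)\<^sup>2 * (M - ?q (shift (z /\<^sub>R real n) f1))"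
          by (simp add: sum_subtractf algebra_simps power2_eq_square)
      qed
      also have "\<dots> \<le> (\<Sum>z\<in>Z. (real n)\<^sup>2 * (C * norm z / real n))"
      proof (intro sum_mono mult_left_mono)
        fix z
        show "M - ?q (shift (z /\<^sub>R real n) f1) \<le> C * norm z / real n"
          using flux_shift_diff[OF FD(2)[OF f1(1)], of \<alpha> \<beta> u w "z /\<^sub>R real n"] n(1)
          by (simp add: M_def C_def divide_inverse abs_le_iff algebra_simps)
      qed auto
      also have "\<dots> = (\<Sum>j<n. \<Sum>k<n. C * S / real n)"
        using n(1) by (simp add: S_def sum_distrib_left sum_divide_distrib power2_eq_square algebra_simps)
      finally have le: "(\<Sum>j<n. \<Sum>k<n. \<Sum>z\<in>Z. M - ?q (shift z (c j k f1))) \<le> (\<Sum>j<n. \<Sum>k<n. C * S / real n)" .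
      have "\<exists>j<n. \<exists>k<n. (\<Sum>z\<in>Z. M - ?q (shift z (c j k f1))) \<le> C * S / real n"
      proof (rule ccontr)
        assume "\<not> ?thesis"
        then have "(\<Sum>j<n. \<Sum>k<n. C * S / real n) < (\<Sum>j<n. \<Sum>k<n. \<Sum>z\<in>Z. M - ?q (shift z (c j k f1)))"
          using n(1) by (intro sum_strict_mono) (auto simp: not_le)
        with le show False by simp
      qed
      then obtain j k where jk: "(\<Sum>z\<in>Z. M - ?q (shift z (c j k f1))) \<le> C * S / real n" by blast
      define g where "g = c j k f1"
      have g: "g \<in> F" using cF f1 by (simp add: g_def)
      have "g \<in> E (z, d)" if zd: "(z, d) \<in> I'" for z d
      proof -
        have z: "z \<in> Z" using zd by (force simp: Z_def)
        have "M - ?q (shift z g) \<le> (\<Sum>z\<in>Z. M - ?q (shift z g))"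
          by (rule member_le_sum[OF z]) (auto intro!: M renormalizableD F(3) g \<open>finite Z\<close>)
        also have "\<dots> < e" using jk n(2) by (simp add: g_def)
        also have "e \<le> d" using zd I'(1) by (force simp: e_def intro!: Min_le)
        finally show ?thesis using g by (simp add: E_def)
      qed
      then show "F \<inter> (\<Inter>i\<in>I'. E i) \<noteq> {}" using g by force
    qed
    then obtain f where f: "f \<in> F" "\<And>z e. e > 0 \<Longrightarrow> f \<in> E (z, e)" by auto
    have "?q (shift z f) = M" for z
    proof (rule antisym)
      show "?q (shift z f) \<le> M" by (intro M renormalizableD F(3) f)
      show "M \<le> ?q (shift z f)"
      proof (rule field_le_epsilon)
        fix e :: real assume "e > 0"
        from f(2)[OF this, of z] show "M \<le> ?q (shift z f) + e" by (simp add: E_def)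
      qed
    qed
    with f show ?thesis by (auto simp: G_def)
  qed
  moreover have "renormalizable G"
    unfolding renormalizable_def
  proof safe
    fix f z assume f: "f \<in> G"
    then show "shift z f \<in> G"
      using F(3) by (auto simp: G_def shift_shift intro!: renormalizableD)
  next
    fix f and n :: nat assume f: "f \<in> G" and n: "n > 0"
    have "?q (shift z (magnify n f)) = M" for z
    proof -
      define g where "g = shift (z /\<^sub>R real n) f"
      define c where "c j k = magnify n (shift ((real j *\<^sub>R u + real k *\<^sub>R w) /\<^sub>R real n) g)" for j k
      have g: "g \<in> F" "?q g = M" using f F(3) by (auto simp: G_def g_def intro!: renormalizableD)
      have c: "c j k \<in> F" for j k using g F(3) n by (auto simp: c_def intro!: renormalizableD)
      \<comment> \<open>The cells average to \<open>M\<close> and none exceeds \<open>M\<close>, so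
        each has flux exactly \<open>M\<close>. The cell \<open>(0, 0)\<close> is
        \<open>shift z (magnify n f)\<close>.\<close>
      have "(\<Sum>j<n. \<Sum>k<n. ?q (c j k)) = (real n)\<^sup>2 * M"
        unfolding c_def using flux_subdivide[OF FD(5)[OF g(1)] n] g(2) by simp
      then have "(\<Sum>j<n. \<Sum>k<n. M - ?q (c j k)) = 0"
        by (simp add: sum_subtractf power2_eq_square)
      moreover have "(\<Sum>k<n. M - ?q (c j k)) \<ge> 0" for j using M[OF c] by (intro sum_nonneg) simp
      ultimately have "(\<Sum>k<n. M - ?q (c 0 k)) = 0"
        using n by (subst (asm) sum_nonneg_eq_0_iff) auto
      then have "M - ?q (c 0 0) = 0"
        using n M[OF c] by (subst (asm) sum_nonneg_eq_0_iff) auto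
      moreover have "c 0 0 = shift z (magnify n f)"
        using n shift_magnify[of n z 0 f] f FD(1) by (simp add: c_def g_def G_def shift_shift shift_0)
      ultimately show ?thesis by simp
    qed
    then show "magnify n f \<in> G"
      using f F(3) n by (auto simp: G_def intro!: renormalizableD)
  qed
  moreover have "?q f = M" if "f \<in> G" for f
  proof -
    have "?q (shift 0 f) = M" "f \<in> F" using that by (auto simp: G_def)
    moreover have "f 0 = 0" by (rule FD(1)) fact
    ultimately show ?thesis by (simp add: shift_0)
  qed
  moreover have "G \<subseteq> F" by (auto simp: G_def)
  ultimately show ?thesis using M by (intro that[of G M])
qed

section \<open>Minimal families and their real-linear members\<close>

lemma additive_lipschitz_imp_real_linear:
  fixes D :: "'a::real_normed_vector \<Rightarrow> complex"
  assumes add: "\<And>x y. D (x + y) = D x + D y" and lip: "\<And>x. cmod (D x) \<le> norm x"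
  shows "D (r *\<^sub>R x) = of_real r * D x"
proof -
  interpret additive D by standard (rule add)
  have cont: "isCont D y" for y
  proof -
    have "((\<lambda>t. D t - D y) \<longlongrightarrow> 0) (at y)"
    proof (rule tendsto_0_le[where f="\<lambda>t. t - y" and K=1])
      show "((\<lambda>t. t - y) \<longlongrightarrow> 0) (at y)"
        by (rule LIM_zero) (rule tendsto_ident_at)
      show "\<forall>\<^sub>F t in at y. norm (D t - D y) \<le> norm (t - y) * 1"
        using lip by (auto simp: diff[symmetric] intro!: always_eventually)
    qed
    then show ?thesis by (simp add: isCont_def LIM_zero_iff)
  qed
  have nat: "D (of_nat n *\<^sub>R x) = of_nat n * D x" for n x
    by (induction n) (simp_all add: zero add algebra_simps)
  have int: "D (of_int k *\<^sub>R x) = of_int k * D x" for k x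
  proof (cases k rule: int_cases2)
    case (nonneg n) then show ?thesis using nat[of n x] by simp
  next
    case (nonpos n) then show ?thesis using nat[of n x] by (simp add: minus)
  qed
  have quot: "D (of_rat q *\<^sub>R x) = of_real (of_rat q) * D x" for q x
  proof -
    obtain a b where q: "q = Fract a b" "b > 0" by (cases q) auto
    have "of_int b * D (of_rat q *\<^sub>R x) = D (of_int b *\<^sub>R of_rat q *\<^sub>R x)" by (simp only: int)
    also have "of_int b *\<^sub>R of_rat q *\<^sub>R x = of_int a *\<^sub>R x"
      using q by (simp add: of_rat_rat)
    finally show ?thesis using q by (simp add: int of_rat_rat field_simps)
  qed
  have "closed {r. D (r *\<^sub>R x) = of_real r * D x}"
    using cont by (intro closed_Collect_eq continuous_intros continuous_on_compose2[OF continuous_at_imp_continuous_on[of UNIV D]]) auto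
  then have "closure \<rat> \<subseteq> {r. D (r *\<^sub>R x) = of_real r * D x}"
    using quot by (intro closure_minimal) (auto elim!: Rats_cases)
  then show ?thesis by (auto simp: Rats_closure_real)
qed

text \<open>Zorn's lemma is applied to complements, which turns minimal sets into maximal ones. A
  chain has a lower bound because its finite parts have least members and \<open>F\<close> is
  compact, so the intersection of the chain is non-empty.\<close>

lemma exists_minimal_renormalizable:
  fixes F :: "('a::real_normed_vector \<Rightarrow> complex) set"
  assumes F: "closed F" "F \<noteq> {}" "renormalizable F" "F \<subseteq> pointed_lipschitz"
  obtains G where "closed G" "G \<noteq> {}" "renormalizable G" "G \<subseteq> F"
    "\<And>H. closed H \<Longrightarrow> H \<noteq> {} \<Longrightarrow> renormalizable H \<Longrightarrow> H \<subseteq> G \<Longrightarrow> H = G"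
proof -
  define \<A> where "\<A> = {G. closed G \<and> G \<noteq> {} \<and> renormalizable G \<and> G \<subseteq> F}"
  have "compact F" using F compact_pointed_lipschitz by (metis compact_Int_closed inf.absorb_iff2)
  have "\<exists>M\<in>uminus ` \<A>. \<forall>X\<in>uminus ` \<A>. M \<subseteq> X \<longrightarrow> X = M"
  proof (rule subset_Zorn)
    fix \<C> assume ch: "subset.chain (uminus ` \<A>) \<C>"
    show "\<exists>U\<in>uminus ` \<A>. \<forall>X\<in>\<C>. X \<subseteq> U"
    proof (cases "\<C> = {}")
      case True
      then show ?thesis using F by (auto simp: \<A>_def)
    next
      case False
      define \<B> where "\<B> = uminus ` \<C>"
      have \<B>: "G \<in> \<A>" if "G \<in> \<B>" for G
        using ch that by (auto simp: \<B>_def subset.chain_def)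
      have "\<B> \<noteq> {}" using False by (simp add: \<B>_def)
      have total: "G \<subseteq> H \<or> H \<subseteq> G" if "G \<in> \<B>" "H \<in> \<B>" for G H
      proof -
        obtain X Y where XY: "X \<in> \<C>" "Y \<in> \<C>" "G = - X" "H = - Y" using \<open>G \<in> \<B>\<close> \<open>H \<in> \<B>\<close> unfolding \<B>_def by blast
        then have "X \<subseteq> Y \<or> Y \<subseteq> X" using ch by (auto simp: subset_chain_def)
        with XY show ?thesis by blast
      qed
      have "F \<inter> \<Inter>\<B> \<noteq> {}"
      proof (rule compact_imp_fip[OF \<open>compact F\<close>])
        fix \<B>' assume "finite \<B>'" "\<B>' \<subseteq> \<B>"
        then have "\<B>' = {} \<or> \<Inter>\<B>' \<in> \<B>'"
        proof (induction rule: finite_induct)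
          case (insert G \<B>')
          show ?case
          proof (cases "\<B>' = {}")
            case False
            then have "\<Inter>\<B>' \<in> \<B>'" using insert by blast
            then have "G \<subseteq> \<Inter>\<B>' \<or> \<Inter>\<B>' \<subseteq> G" using insert.prems by (intro total) auto
            then have "\<Inter>(insert G \<B>') = G \<or> \<Inter>(insert G \<B>') = \<Inter>\<B>'" by auto
            then show ?thesis using \<open>\<Inter>\<B>' \<in> \<B>'\<close> by (metis insertI1 insertI2)
          qed simp
        qed simp
        moreover have "F \<inter> G \<noteq> {}" if "G \<in> \<B>" for G using \<B>[OF that] by (auto simp: \<A>_def)
        ultimately show "F \<inter> \<Inter>\<B>' \<noteq> {}" using F(2) \<open>\<B>' \<subseteq> \<B>\<close> by auto
      qed (use \<B> in \<open>auto simp: \<A>_def\<close>)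
      then have "\<Inter>\<B> \<in> \<A>"
      proof -
        have "closed (\<Inter>\<B>)" "\<Inter>\<B> \<subseteq> F" using \<B> \<open>\<B> \<noteq> {}\<close> by (auto simp: \<A>_def intro!: closed_Inter)
        moreover have "renormalizable (\<Inter>\<B>)" using \<B> by (auto simp: \<A>_def renormalizable_def)
        ultimately show ?thesis using \<open>F \<inter> \<Inter>\<B> \<noteq> {}\<close> by (auto simp: \<A>_def)
      qed
      moreover have "X \<subseteq> - \<Inter>\<B>" if "X \<in> \<C>" for X using that by (auto simp: \<B>_def)
      ultimately show ?thesis by blast
    qed
  qed
  then obtain G where "G \<in> \<A>" and "\<And>H. H \<in> \<A> \<Longrightarrow> - G \<subseteq> - H \<Longrightarrow> - H = - G" by auto
  then show ?thesis by (intro that[of G]) (auto simp: \<A>_def)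
qed

text \<open>On a minimal family every increment is extremal, hence constant.\<close>

lemma exists_linear_in_renormalizable:
  fixes F :: "('a::real_normed_vector \<Rightarrow> complex) set"
  assumes F: "closed F" "F \<noteq> {}" "renormalizable F" "F \<subseteq> pointed_lipschitz"
  obtains D where "D \<in> F" "\<And>x y. D (x + y) = D x + D y" "\<And>r x. D (r *\<^sub>R x) = of_real r * D x"
proof -
  obtain G where G: "closed G" "G \<noteq> {}" "renormalizable G" "G \<subseteq> F"
    and min: "\<And>H. closed H \<Longrightarrow> H \<noteq> {} \<Longrightarrow> renormalizable H \<Longrightarrow> H \<subseteq> G \<Longrightarrow> H = G"
    using exists_minimal_renormalizable[OF F] by blast
  have GL: "G \<subseteq> pointed_lipschitz" using G(4) F(4) by blast
  note GD = pointed_lipschitzD[OF subsetD[OF GL]]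
  have const: "\<exists>M. \<forall>f\<in>G. Re (\<alpha> * f u) = M" for \<alpha> u
  proof -
    obtain M H where H: "closed H" "H \<noteq> {}" "renormalizable H" "H \<subseteq> G"
      and M: "\<And>f. f \<in> H \<Longrightarrow> flux \<alpha> 0 u 0 f = M"
      by (rule exists_extremal_family[OF G(1,2,3) GL, of \<alpha> 0 u 0]) blast
    have "H = G" by (rule min[OF H])
    moreover have "flux \<alpha> 0 u 0 f = Re (\<alpha> * f u)" if "f \<in> G" for f
      using GD(1)[OF that] by (simp add: flux_def slab_def)
    ultimately show ?thesis using M by metis
  qed
  obtain D where D: "D \<in> G" using G(2) by blast
  have eq: "f u = D u" if "f \<in> G" for f u
  proof (rule complex_eqI)
    show "Re (f u) = Re (D u)" using const[of 1 u] that D by auto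
    show "Im (f u) = Im (D u)" using const[of "-\<i>" u] that D by auto
  qed
  \<comment> \<open>\<open>D\<close> is the only member of \<open>G\<close>, so
    \<open>shift x D = D\<close>, which is additivity.\<close>
  have add: "D (x + y) = D x + D y" for x y
    using eq[OF renormalizableD(1)[OF G(3) D], of x y] by (simp add: shift_def algebra_simps)
  show ?thesis
  proof (rule that)
    show "D \<in> F" using D G(4) by blast
    show "D (r *\<^sub>R x) = of_real r * D x" for r x
      by (rule additive_lipschitz_imp_real_linear[OF add GD(4)[OF D]])
  qed (rule add)
qed

text \<open>The extremal family is itself closed and renormalizable, hence contains a real-linear
  map. For such a map the integrands of both slabs are constant, which gives the explicit value of
  the flux.\<close>

lemma exists_linear_maximizer:
  fixes F :: "('a::real_normed_vector \<Rightarrow> complex) set"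
  assumes F: "closed F" "F \<noteq> {}" "renormalizable F" "F \<subseteq> pointed_lipschitz"
  obtains D where "D \<in> F" "\<And>x y. D (x + y) = D x + D y" "\<And>r x. D (r *\<^sub>R x) = of_real r * D x"
    "\<And>f. f \<in> F \<Longrightarrow> flux \<alpha> \<beta> u w f \<le> Re (\<alpha> * D u + \<beta> * D w)"
proof -
  obtain M G where G: "closed G" "G \<noteq> {}" "renormalizable G" "G \<subseteq> F"
    and M: "\<And>f. f \<in> F \<Longrightarrow> flux \<alpha> \<beta> u w f \<le> M" "\<And>f. f \<in> G \<Longrightarrow> flux \<alpha> \<beta> u w f = M"
    by (rule exists_extremal_family[OF F]) blast
  have GL: "G \<subseteq> pointed_lipschitz" using G(4) F(4) by blast
  obtain D where D: "D \<in> G" "\<And>x y. D (x + y) = D x + D y" "\<And>r x. D (r *\<^sub>R x) = of_real r * D x"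
    using exists_linear_in_renormalizable[OF G(1,2,3) GL] by blast
  have "Re (\<alpha> * D u + \<beta> * D w) = flux \<alpha> \<beta> u w D"
    by (simp add: flux_def slab_def D(2))
  also have "flux \<alpha> \<beta> u w D = M" by (rule M(2)[OF D(1)])
  finally have "flux \<alpha> \<beta> u w f \<le> Re (\<alpha> * D u + \<beta> * D w)" if "f \<in> F" for f
    using M(1)[OF that] by simp
  then show ?thesis using D G(4) by (intro that[of D]) auto
qed

subsection \<open>Functions with vanishing parallelogram integrals\<close>

text \<open>One of the three points lies between the other two. Reversing a segment changes the sign
  of the integral, so all six orders reduce to splitting one segment.\<close>

lemma contour_integral_linepath_collinear:
  assumes cont: "continuous_on UNIV f"
    and x: "x = z + of_real r * e" and y: "y = z + of_real s * e" and w: "w = z + of_real t * e"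
  shows "contour_integral (linepath x y) f + contour_integral (linepath y w) f = contour_integral (linepath x w) f"
proof -
  have between: "y \<in> closed_segment x w"
    if "r \<le> s" "s \<le> t" "x = z + of_real r * e" "y = z + of_real s * e" "w = z + of_real t * e"
    for r s t x y w
  proof (cases "r = t")
    case True then show ?thesis using that by auto
  next
    case False
    define u where "u = (s - r) / (t - r)"
    have "u * (t - r) = s - r" using False by (simp add: u_def)
    then have "s = (1 - u) * r + u * t" by (simp add: algebra_simps)
    then have su: "of_real s = (1 - complex_of_real u) * of_real r + of_real u * of_real t"
      by (metis of_real_1 of_real_add of_real_diff of_real_mult)
    have "y = (1 - complex_of_real u) * x + of_real u * w"
      unfolding that(3-5) su by (simp add: algebra_simps)
    then show ?thesis
      using False that(1,2) unfolding closed_segment_def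
      by (intro CollectI exI[of _ u]) (auto simp: scaleR_conv_of_real u_def)
  qed
  have c: "continuous_on S f" for S using cont continuous_on_subset by blast
  have split: "contour_integral (linepath a b) f = contour_integral (linepath a p) f + contour_integral (linepath p b) f"
    if "p \<in> closed_segment a b" for a p b
    using contour_integral_split_linepath[OF c that] .
  have rev: "contour_integral (linepath a b) f = - contour_integral (linepath b a) f" for a b
    using contour_integral_reverse_linepath[OF c] .
  have "(r \<le> s \<and> s \<le> t) \<or> (t \<le> s \<and> s \<le> r) \<or> (s \<le> r \<and> r \<le> t) \<or> (t \<le> r \<and> r \<le> s)
      \<or> (r \<le> t \<and> t \<le> s) \<or> (s \<le> t \<and> t \<le> r)" by linarith
  then have "y \<in> closed_segment x w \<or> x \<in> closed_segment y w \<or> w \<in> closed_segment x y"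
    using between[of r s t, OF _ _ x y w] between[of t s r, OF _ _ w y x] between[of s r t, OF _ _ y x w]
      between[of t r s, OF _ _ w x y] between[of r t s, OF _ _ x w y] between[of s t r, OF _ _ y w x]
    by (auto simp: closed_segment_commute)
  then consider "y \<in> closed_segment x w" | "x \<in> closed_segment y w" | "w \<in> closed_segment x y" by blast
  then show ?thesis
  proof cases
    case 1 then show ?thesis using split by simp
  next
    case 2 then show ?thesis using split[OF 2] rev[of x y] by simp
  next
    case 3 then show ?thesis using split[OF 3] rev[of w y] by simp
  qed
qed

text \<open>Morera's argument with axis-parallel paths. Integrating horizontally and then vertically
  controls vertical increments of \<open>F\<close>; the hypothesis for rectangles exchanges the
  order and so controls horizontal ones.\<close>

lemma lipschitz_parallelogram_primitive:
  fixes f :: "complex \<Rightarrow> complex"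
  assumes lip: "L-lipschitz_on UNIV f"
    and par: "\<And>a c d. contour_integral (linepath a (a + c)) f + contour_integral (linepath (a + c) (a + c + d)) f
      = contour_integral (linepath a (a + d)) f + contour_integral (linepath (a + d) (a + c + d)) f"
  obtains F where "\<And>z. (F has_field_derivative f z) (at z)"
proof -
  have cont: "continuous_on S f" for S 
    using lipschitz_on_continuous_on[OF lip] continuous_on_subset by blast
  have L: "L \<ge> 0" using lip by (simp add: lipschitz_on_def)
  define I where "I a b = contour_integral (linepath a b) f" for a b
  define F where "F z = I 0 (Re z) + I (Re z) z" for z
  have F': "F z = I 0 (\<i> * Im z) + I (\<i> * Im z) z" for z
    using par[of 0 "Re z" "\<i> * Im z"] by (simp add: F_def I_def complex_eq[symmetric])
  have bound: "cmod (I a b - (b - a) * f z) \<le> L * r * cmod (b - a)"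
    if "cmod (a - z) \<le> r" "cmod (b - z) \<le> r" for a b z r
  proof -
    have "r \<ge> 0" using that(1) norm_ge_zero order_trans by blast
    have "I a b - (b - a) * f z = contour_integral (linepath a b) (\<lambda>w. f w - f z)"
      unfolding I_def by (subst contour_integral_diff) (auto intro!: contour_integrable_continuous_linepath cont continuous_intros)
    also have "cmod \<dots> \<le> L * r * cmod (b - a)"
    proof (intro contour_integral_bound_linepath contour_integrable_continuous_linepath cont continuous_intros)
      fix w assume "w \<in> closed_segment a b"
      moreover have "closed_segment a b \<subseteq> cball z r"
        using that by (intro closed_segment_subset) (auto simp: dist_norm norm_minus_commute)
      ultimately have "dist w z \<le> r" by (auto simp: dist_commute)
      then show "cmod (f w - f z) \<le> L * r"
        using lipschitz_onD[OF lip, of w z] L by (auto simp: dist_norm intro: order_trans mult_left_mono)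
    qed (use L \<open>r \<ge> 0\<close> in auto)
    finally show ?thesis .
  qed
  have "(F has_field_derivative f z) (at z)" for z
  proof -
    have est: "cmod (F w - F z - (w - z) * f z) \<le> 2 * L * cmod (w - z) * cmod (w - z)" for w
    proof -
      \<comment> \<open>The corner reached from \<open>z\<close> horizontally, before moving
        vertically to \<open>w\<close>.\<close>
      define m where "m = Complex (Re w) (Im z)"
      have "I (Re w) m + I m w = I (Re w) w"
        unfolding I_def
        by (rule contour_integral_linepath_collinear[OF cont, where z="Re w" and e="\<i>" and r=0 and s="Im z" and t="Im w"])
           (auto simp: m_def complex_eq_iff)
      then have 1: "F w - F m = I m w" by (simp add: F_def m_def algebra_simps)
      have "I (\<i> * Im z) z + I z m = I (\<i> * Im z) m"
        unfolding I_def
        by (rule contour_integral_linepath_collinear[OF cont, where z="\<i> * Im z" and e=1 and r=0 and s="Re z" and t="Re w"])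
           (auto simp: m_def complex_eq_iff)
      then have 2: "F m - F z = I z m" unfolding F' by (simp add: m_def algebra_simps)
      have mz: "cmod (m - z) \<le> cmod (w - z)" "cmod (w - m) \<le> cmod (w - z)"
        by (auto simp: m_def cmod_def)
      have "F w - F z - (w - z) * f z = (I z m - (m - z) * f z) + (I m w - (w - m) * f z)"
        using 1 2 by (simp add: algebra_simps)
      also have "cmod \<dots> \<le> L * cmod (w - z) * cmod (m - z) + L * cmod (w - z) * cmod (w - m)"
        using mz by (intro order_trans[OF norm_triangle_ineq add_mono] bound) auto
      also have "\<dots> \<le> L * cmod (w - z) * cmod (w - z) + L * cmod (w - z) * cmod (w - z)"
        using mz L by (intro add_mono mult_left_mono) auto
      finally show ?thesis by simp
    qed
    have "((\<lambda>w. (F w - F z) / (w - z) - f z) \<longlongrightarrow> 0) (at z)"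
    proof (rule tendsto_0_le)
      show "((\<lambda>w. w - z) \<longlongrightarrow> 0) (at z)" by (rule LIM_zero) (rule tendsto_ident_at)
      show "\<forall>\<^sub>F w in at z. cmod ((F w - F z) / (w - z) - f z) \<le> cmod (w - z) * (2 * L)"
      proof (rule eventually_mono[OF eventually_neq_at_within])
        fix w assume "w \<noteq> z"
        then have "(F w - F z) / (w - z) - f z = (F w - F z - (w - z) * f z) / (w - z)"
          by (simp add: field_simps)
        then have "cmod ((F w - F z) / (w - z) - f z) = cmod (F w - F z - (w - z) * f z) / cmod (w - z)"
          by (simp add: norm_divide)
        also have "\<dots> \<le> cmod (w - z) * (2 * L)"
          using est[of w] \<open>w \<noteq> z\<close> by (simp add: field_simps)
        finally show "cmod ((F w - F z) / (w - z) - f z) \<le> cmod (w - z) * (2 * L)" .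
      qed
    qed
    then show ?thesis by (simp add: has_field_derivative_iff LIM_zero_iff)
  qed
  then show ?thesis by (rule that)
qed

text \<open>As the derivative of an entire primitive, \<open>f\<close> is entire. The Lipschitz
  bound gives linear growth, and Liouville's theorem leaves a polynomial of degree at most
  1.\<close>

lemma lipschitz_parallelogram_imp_affine:
  fixes f :: "complex \<Rightarrow> complex"
  assumes lip: "L-lipschitz_on UNIV f"
    and par: "\<And>a c d. contour_integral (linepath a (a + c)) f + contour_integral (linepath (a + c) (a + c + d)) f
      = contour_integral (linepath a (a + d)) f + contour_integral (linepath (a + d) (a + c + d)) f"
  shows "f z = f 0 + z * deriv f 0"
proof -
  obtain F where F: "\<And>z. (F has_field_derivative f z) (at z)"
    using lipschitz_parallelogram_primitive[OF assms] by blast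
  have "F holomorphic_on UNIV" using F by (auto simp: holomorphic_on_open)
  then have "deriv F holomorphic_on UNIV" by (intro holomorphic_deriv) auto
  moreover have "deriv F = f" using F DERIV_imp_deriv by blast
  ultimately have hol: "f holomorphic_on UNIV" by simp
  have "f z = (\<Sum>k\<le>1. (deriv ^^ k) f 0 / fact k * z ^ k)"
  proof (rule Liouville_polynomial[OF hol])
    fix w :: complex assume w: "1 \<le> cmod w"
    have "cmod (f w) \<le> cmod (f w - f 0) + cmod (f 0)" by (metis norm_triangle_sub add.commute)
    also have "\<dots> \<le> L * cmod w + cmod (f 0) * cmod w"
      using lipschitz_onD[OF lip, of w 0] mult_left_mono[OF w, of "cmod (f 0)"] by (simp add: dist_norm)
    finally show "cmod (f w) \<le> (L + cmod (f 0)) * cmod w ^ 1" by (simp add: algebra_simps)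
  qed
  then show ?thesis by (simp add: mult.commute)
qed

subsection \<open>Invertibility and the spectrum\<close>

interpretation scaleC: vector_space "scaleC :: complex \<Rightarrow> 'a \<Rightarrow> 'a::complex_banach_algebra"
  by (rule vector_space_scaleC)

lemma invertible_elem_1: "invertible_elem (1 :: 'a::complex_banach_algebra)"
  unfolding invertible_elem_def by (rule exI[of _ 1]) simp

lemma not_invertible_elem_0: "\<not> invertible_elem (0 :: 'a::complex_banach_algebra)"
  by (simp add: invertible_elem_def)

lemma invertible_elem_mult:
  fixes a b :: "'a::complex_banach_algebra"
  assumes "invertible_elem a" "invertible_elem b"
  shows "invertible_elem (a * b)"
proof -
  obtain a' b' where "a * a' = 1" "a' * a = 1" "b * b' = 1" "b' * b = 1"
    using assms by (auto simp: invertible_elem_def)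
  then have "a * b * (b' * a') = 1" "b' * a' * (a * b) = 1"
    by (metis mult.assoc mult_1)+
  then show ?thesis by (auto simp: invertible_elem_def)
qed

lemma invertible_elem_power:
  "invertible_elem (a :: 'a::complex_banach_algebra) \<Longrightarrow> invertible_elem (a ^ n)"
  by (induction n) (auto intro: invertible_elem_1 invertible_elem_mult)

lemma invertible_elem_scaleC:
  fixes a :: "'a::complex_banach_algebra"
  assumes "c \<noteq> 0" "invertible_elem a"
  shows "invertible_elem (c *\<^sub>C a)"
proof -
  obtain b where "a * b = 1" "b * a = 1" using assms by (auto simp: invertible_elem_def)
  then have "(c *\<^sub>C a) * (inverse c *\<^sub>C b) = 1" "(inverse c *\<^sub>C b) * (c *\<^sub>C a) = 1"
    using assms(1) by (simp_all add: mult_scaleC_left mult_scaleC_right scaleC_scaleC scaleC_one)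
  then show ?thesis by (auto simp: invertible_elem_def)
qed

lemma norm_power_le:
  "norm ((b :: 'a::complex_banach_algebra) ^ n) \<le> norm (1::'a) * norm b ^ n"
proof (induction n)
  case (Suc n)
  have "norm (b ^ Suc n) \<le> norm b * norm (b ^ n)" by (simp add: norm_mult_ineq)
  also have "\<dots> \<le> norm b * (norm (1::'a) * norm b ^ n)" by (intro mult_left_mono Suc) simp
  finally show ?case by (simp add: algebra_simps)
qed simp

text \<open>Neumann series. Its terms are dominated by a geometric series with the factor
  \<open>norm 1\<close>, as the unit may have norm different from 1.\<close>

lemma invertible_elem_one_minus:
  fixes b :: "'a::complex_banach_algebra"
  assumes "norm b < 1"
  shows "invertible_elem (1 - b)"
proof -
  have "summable (\<lambda>n. norm (1::'a) * norm b ^ n)"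
    using assms by (intro summable_mult summable_geometric) simp
  then have s: "summable (\<lambda>n. b ^ n)"
    by (rule summable_comparison_test') (rule norm_power_le)
  define S where "S = (\<Sum>n. b ^ n)"
  have "b * S = (\<Sum>n. b ^ Suc n)" using suminf_mult[OF s, of b] by (simp add: S_def)
  moreover have "S * b = (\<Sum>n. b ^ Suc n)"
    using suminf_mult2[OF s, of b] by (simp add: S_def power_Suc2 del: power_Suc)
  moreover have "(\<Sum>n. b ^ Suc n) = S - 1"
    using suminf_split_head[OF s] by (simp add: S_def)
  ultimately have "(1 - b) * S = 1" "S * (1 - b) = 1"
    by (simp_all add: left_diff_distrib right_diff_distrib)
  then show ?thesis by (auto simp: invertible_elem_def)
qed

lemma norm_spectrum_le:
  fixes a :: "'a::complex_banach_algebra"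
  assumes "\<mu> \<in> spectrum a"
  shows "cmod \<mu> \<le> norm a"
proof (rule ccontr)
  assume neg: "\<not> ?thesis"
  then have "\<mu> \<noteq> 0" by auto
  have "norm ((1 / \<mu>) *\<^sub>C a) < 1"
    using neg \<open>\<mu> \<noteq> 0\<close> by (simp add: norm_scaleC norm_divide)
  then have "invertible_elem ((- \<mu>) *\<^sub>C (1 - (1 / \<mu>) *\<^sub>C a))"
    using \<open>\<mu> \<noteq> 0\<close> by (intro invertible_elem_scaleC invertible_elem_one_minus) auto
  also have "(- \<mu>) *\<^sub>C (1 - (1 / \<mu>) *\<^sub>C a) = a - \<mu> *\<^sub>C 1"
    using \<open>\<mu> \<noteq> 0\<close> by (simp add: scaleC.scale_right_diff_distrib scaleC_scaleC scaleC_one)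
  finally show False using assms by (simp add: spectrum_def)
qed

text \<open>With \<open>d\<close> the inverse of \<open>a - \<mu>\<close>, one has
  \<open>a - \<nu> = (1 - (\<nu> - \<mu>) d) (a - \<mu>)\<close>, and the first factor is invertible
  for \<nu> close to \<mu>.\<close>

lemma closed_spectrum: "closed (spectrum (a :: 'a::complex_banach_algebra))"
  unfolding closed_def
proof (rule openI)
  fix \<mu> assume "\<mu> \<in> - spectrum a"
  then obtain d where d: "(a - \<mu> *\<^sub>C 1) * d = 1" "d * (a - \<mu> *\<^sub>C 1) = 1"
    by (auto simp: spectrum_def invertible_elem_def)
  have "\<nu> \<in> - spectrum a" if \<nu>: "\<nu> \<in> ball \<mu> (1 / (norm d + 1))" for \<nu>
  proof -
    have "cmod (\<nu> - \<mu>) * (norm d + 1) < 1"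
      using \<nu> norm_ge_zero[of d] by (simp add: dist_norm norm_minus_commute field_simps add_nonneg_pos)
    moreover have "cmod (\<nu> - \<mu>) * norm d \<le> cmod (\<nu> - \<mu>) * (norm d + 1)"
      by (intro mult_left_mono) auto
    ultimately have "norm ((\<nu> - \<mu>) *\<^sub>C d) < 1" unfolding norm_scaleC by linarith
    then have "invertible_elem ((1 - (\<nu> - \<mu>) *\<^sub>C d) * (a - \<mu> *\<^sub>C 1))"
      using d by (intro invertible_elem_mult invertible_elem_one_minus) (auto simp: invertible_elem_def)
    also have "(1 - (\<nu> - \<mu>) *\<^sub>C d) * (a - \<mu> *\<^sub>C 1) = a - \<nu> *\<^sub>C 1"
      by (simp add: left_diff_distrib mult_scaleC_left d scaleC.scale_left_diff_distrib)
    finally show ?thesis by (simp add: spectrum_def)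
  qed
  then show "\<exists>e>0. ball \<mu> e \<subseteq> - spectrum a"
    by (intro exI[of _ "1 / (norm d + 1)"]) (auto simp: add_nonneg_pos)
qed

lemma spectrum_scaleC_one: "spectrum (c *\<^sub>C (1 :: 'a::complex_banach_algebra)) = {c}"
proof -
  have "c *\<^sub>C (1::'a) - \<mu> *\<^sub>C 1 = (c - \<mu>) *\<^sub>C 1" for \<mu>
    by (simp add: scaleC.scale_left_diff_distrib)
  then show ?thesis
    by (auto simp: spectrum_def not_invertible_elem_0 intro!: invertible_elem_scaleC invertible_elem_1)
qed

lemma spectrum_scaleC:
  fixes a :: "'a::complex_banach_algebra"
  assumes "\<mu> \<in> spectrum a" "c \<noteq> 0"
  shows "c * \<mu> \<in> spectrum (c *\<^sub>C a)"
proof (rule ccontr)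
  assume "\<not> ?thesis"
  then have "invertible_elem (inverse c *\<^sub>C (c *\<^sub>C a - (c * \<mu>) *\<^sub>C 1))"
    using \<open>c \<noteq> 0\<close> by (intro invertible_elem_scaleC) (auto simp: spectrum_def)
  also have "inverse c *\<^sub>C (c *\<^sub>C a - (c * \<mu>) *\<^sub>C 1) = a - \<mu> *\<^sub>C 1"
    using \<open>c \<noteq> 0\<close> by (simp add: scaleC.scale_right_diff_distrib scaleC_scaleC scaleC_one mult.assoc[symmetric])
  finally show False using assms by (simp add: spectrum_def)
qed

section \<open>Spectral selections as a compact renormalizable family\<close>

definition spectral_selections :: "('a::complex_banach_algebra \<Rightarrow> complex) set"
  where "spectral_selections = {f. f 0 = 0 \<and> (\<forall>x y. f x - f y \<in> spectrum (x - y))}"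

lemma spectral_selectionsD:
  assumes "f \<in> spectral_selections"
  shows "f 0 = 0" "f x - f y \<in> spectrum (x - y)" "f x \<in> spectrum x"
proof -
  show 0: "f 0 = 0" and *: "f x - f y \<in> spectrum (x - y)" for x y
    using assms by (auto simp: spectral_selections_def)
  show "f x \<in> spectrum x" using *[of x 0] 0 by simp
qed

lemma spectral_selections_subset: "spectral_selections \<subseteq> pointed_lipschitz"
proof
  fix f :: "'a \<Rightarrow> complex" assume f: "f \<in> spectral_selections"
  have "1-lipschitz_on UNIV f"
    by (rule lipschitz_onI) (use norm_spectrum_le[OF spectral_selectionsD(2)[OF f]] in \<open>auto simp: dist_norm\<close>)
  then show "f \<in> pointed_lipschitz"
    using spectral_selectionsD(1)[OF f] by (simp add: pointed_lipschitz_def)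
qed

lemma closed_spectral_selections: "closed spectral_selections"
proof -
  have "closed {f :: 'a \<Rightarrow> complex. f x - f y \<in> spectrum (x - y)}" for x y
  proof -
    have "closed ((\<lambda>f :: 'a \<Rightarrow> complex. f x - f y) -` spectrum (x - y))"
      by (intro closed_vimage closed_spectrum continuous_on_diff continuous_on_product_coordinates)
    then show ?thesis by (simp add: vimage_def)
  qed
  then have "closed ({f :: 'a \<Rightarrow> complex. f 0 = 0} \<inter> (\<Inter>x. \<Inter>y. {f. f x - f y \<in> spectrum (x - y)}))"
    by (intro closed_Int closed_INT ballI closed_Collect_eq continuous_on_product_coordinates continuous_on_const) auto
  also have "{f :: 'a \<Rightarrow> complex. f 0 = 0} \<inter> (\<Inter>x. \<Inter>y. {f. f x - f y \<in> spectrum (x - y)}) = spectral_selections"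
    by (auto simp: spectral_selections_def)
  finally show ?thesis .
qed

text \<open>Differences are unaffected by the constant in \<open>shift\<close>, and spectra scale
  with their elements. Homogeneity is absent from \<open>spectral_selections\<close> because
  \<open>shift\<close> need not preserve it.\<close>

lemma renormalizable_spectral_selections: "renormalizable spectral_selections"
  unfolding renormalizable_def
proof safe
  fix f :: "'a \<Rightarrow> complex" and z assume f: "f \<in> spectral_selections"
  have "shift z f x - shift z f y \<in> spectrum (x - y)" for x y
    using spectral_selectionsD(2)[OF f, of "z + x" "z + y"] by (simp add: shift_def)
  then show "shift z f \<in> spectral_selections"
    by (simp add: spectral_selections_def) (simp add: shift_def)
next
  fix f :: "'a \<Rightarrow> complex" and n :: nat assume f: "f \<in> spectral_selections" and n: "n > 0"
  have "magnify n f x - magnify n f y \<in> spectrum (x - y)" for x y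
  proof -
    have "of_nat n * (f (x /\<^sub>R real n) - f (y /\<^sub>R real n)) \<in> spectrum (of_nat n *\<^sub>C (x /\<^sub>R real n - y /\<^sub>R real n))"
      using n by (intro spectrum_scaleC spectral_selectionsD(2)[OF f]) auto
    also have "of_nat n *\<^sub>C (x /\<^sub>R real n - y /\<^sub>R real n) = x - y"
      using n scaleC_of_real[of "real n" "x /\<^sub>R real n - y /\<^sub>R real n"] by (simp flip: scaleR_diff_right)
    finally show ?thesis by (simp add: magnify_def algebra_simps)
  qed
  then show "magnify n f \<in> spectral_selections"
    using spectral_selectionsD(1)[OF f] by (simp add: spectral_selections_def) (simp add: magnify_def)
qed

subsection \<open>Linear functionals with values in the spectrum\<close>

text \<open>The function is a polynomial in \<open>t\<close>, so its derivative is computed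
  algebraically by induction. The free factor \<open>x\<close> absorbs the \<open>a\<close> produced
  when one factor \<open>1 - t a\<close> is split off.\<close>

lemma has_field_derivative_functional_power:
  fixes L :: "'a::complex_banach_algebra \<Rightarrow> complex"
  assumes diff: "\<And>x y. L (x - y) = L x - L y" and scale: "\<And>c x. L (c *\<^sub>C x) = c * L x"
  shows "((\<lambda>t. L (x * (1 - t *\<^sub>C a) ^ Suc n)) has_field_derivative
    - of_nat (Suc n) * L (x * a * (1 - t *\<^sub>C a) ^ n)) (at t)"
proof (induction n arbitrary: x)
  case 0
  have "(\<lambda>t. L (x * (1 - t *\<^sub>C a) ^ Suc 0)) = (\<lambda>t. L x - t * L (x * a))"
    by (simp add: right_diff_distrib mult_scaleC_right diff scale)
  then show ?case by (auto intro!: derivative_eq_intros)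
next
  case (Suc n)
  have step: "L (x * (1 - t *\<^sub>C a) ^ Suc m) = L (x * (1 - t *\<^sub>C a) ^ m) - t * L (x * a * (1 - t *\<^sub>C a) ^ m)" for x t m
    by (simp add: left_diff_distrib right_diff_distrib mult_scaleC_left mult_scaleC_right diff scale mult.assoc)
  have "((\<lambda>t. L (x * (1 - t *\<^sub>C a) ^ Suc n) - t * L (x * a * (1 - t *\<^sub>C a) ^ Suc n)) has_field_derivative
     - of_nat (Suc n) * L (x * a * (1 - t *\<^sub>C a) ^ n)
     - (1 * L (x * a * (1 - t *\<^sub>C a) ^ Suc n) + - of_nat (Suc n) * L (x * a * a * (1 - t *\<^sub>C a) ^ n) * t)) (at t)"
    by (intro DERIV_diff DERIV_mult DERIV_ident Suc)
  also have "- of_nat (Suc n) * L (x * a * (1 - t *\<^sub>C a) ^ n)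
     - (1 * L (x * a * (1 - t *\<^sub>C a) ^ Suc n) + - of_nat (Suc n) * L (x * a * a * (1 - t *\<^sub>C a) ^ n) * t)
     = - of_nat (Suc (Suc n)) * L (x * a * (1 - t *\<^sub>C a) ^ Suc n)"
    unfolding step[of "x * a"] by (simp add: algebra_simps)
  finally show ?case unfolding step[of x _ "Suc n"] .
qed

lemma invertible_elem_one_minus_scaleC_power:
  fixes a :: "'a::complex_banach_algebra"
  assumes "cmod t \<le> 1 / (norm a + 1)"
  shows "invertible_elem ((1 - t *\<^sub>C a) ^ n)"
proof (intro invertible_elem_power invertible_elem_one_minus)
  have "cmod t * norm a \<le> norm a / (norm a + 1)"
    using mult_right_mono[OF assms, of "norm a"] by simp
  also have "\<dots> < 1" by (subst divide_less_eq_1_pos) (auto simp: add_nonneg_pos)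
  finally show "norm (t *\<^sub>C a) < 1" by (simp add: norm_scaleC)
qed

text \<open>
  By connectedness \<open>\<bar>N\<bar> < \<bar>L\<bar>\<close> at \<open>(1 - t a)\<^sup>n\<close> for small \<open>t\<close>, and the Cauchy estimate bounds the
  derivative \<open>- n N a\<close> of the quotient \<open>N / L\<close> independently of \<open>n\<close>.
\<close>

lemma dominated_functional_eq_0:
  fixes L N :: "'a::complex_banach_algebra \<Rightarrow> complex"
  assumes L: "\<And>x y. L (x - y) = L x - L y" "\<And>c x. L (c *\<^sub>C x) = c * L x" "L 1 = 1"
    and N: "\<And>x y. N (x - y) = N x - N y" "\<And>c x. N (c *\<^sub>C x) = c * N x" "N 1 = 0"
    and neq: "\<And>x. invertible_elem x \<Longrightarrow> cmod (L x) \<noteq> cmod (N x)"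
  shows "N a = 0"
proof -
  \<comment> \<open>On the closed disc of radius \<open>R\<close> one has
    \<open>norm (t a) < 1\<close>, so all powers of \<open>1 - t a\<close> are invertible.\<close>
  define R where "R = 1 / (norm a + 1)"
  have R: "R > 0" using norm_ge_zero[of a] by (simp add: R_def add_nonneg_pos)
  have bound: "real (Suc m) * cmod (N a) \<le> 1 / R" for m
  proof -
    define l where "l t = L (1 * (1 - t *\<^sub>C a) ^ Suc m)" for t
    define n where "n t = N (1 * (1 - t *\<^sub>C a) ^ Suc m)" for t
    have dl: "(l has_field_derivative - of_nat (Suc m) * L (1 * a * (1 - t *\<^sub>C a) ^ m)) (at t)" for t
      unfolding l_def by (intro has_field_derivative_functional_power L)
    have dn: "(n has_field_derivative - of_nat (Suc m) * N (1 * a * (1 - t *\<^sub>C a) ^ m)) (at t)" for t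
      unfolding n_def by (intro has_field_derivative_functional_power N)
    have cl: "continuous_on S l" for S
      by (rule DERIV_continuous_on[OF has_field_derivative_at_within[OF dl]])
    have cn: "continuous_on S n" for S
      by (rule DERIV_continuous_on[OF has_field_derivative_at_within[OF dn]])
    have ne: "cmod (l t) \<noteq> cmod (n t)" if "t \<in> cball 0 R" for t
      using that unfolding l_def n_def R_def by (intro neq) (simp add: invertible_elem_one_minus_scaleC_power del: power_Suc)
    have l0: "l 0 = 1" and n0: "n 0 = 0" by (simp_all add: l_def n_def L N)
    have less: "cmod (n t) < cmod (l t)" if t: "t \<in> cball 0 R" for t
    proof (rule ccontr)
      let ?\<phi> = "\<lambda>t. cmod (l t) - cmod (n t)"
      assume "\<not> ?thesis"
      then have "0 \<in> {?\<phi> t..?\<phi> 0}" by (simp add: l0 n0)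
      moreover have "connected (?\<phi> ` cball 0 R)"
        by (intro connected_continuous_image continuous_intros cl cn) simp
      then have "{?\<phi> t..?\<phi> 0} \<subseteq> ?\<phi> ` cball 0 R"
        by (rule connected_contains_Icc) (use t R in auto)
      ultimately have "0 \<in> ?\<phi> ` cball 0 R" by blast
      then obtain s where "s \<in> cball 0 R" "?\<phi> s = 0" by force
      then show False using ne by simp
    qed
    define h where "h t = n t / l t" for t
    have lnz: "l t \<noteq> 0" if "t \<in> cball 0 R" for t using less[OF that] by auto
    have "l holomorphic_on ball 0 R" "n holomorphic_on ball 0 R"
      using dl dn by (auto simp: holomorphic_on_open)
    then have "h holomorphic_on ball 0 R"
      unfolding h_def using lnz by (intro holomorphic_on_divide) auto
    moreover have "continuous_on (cball 0 R) h"
      unfolding h_def using lnz by (intro continuous_intros cl cn) auto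
    moreover have "cmod (h t) \<le> 1" if "cmod (0 - t) = R" for t
      using less[of t] that by (simp add: h_def norm_divide divide_le_eq_1)
    ultimately have "cmod ((deriv ^^ 1) h 0) \<le> fact 1 * 1 / R ^ 1"
      by (intro Cauchy_inequality R) auto
    moreover have "(h has_field_derivative - of_nat (Suc m) * N a) (at 0)"
      unfolding h_def using DERIV_divide[OF dn[of 0] dl[of 0]] by (simp add: l0 n0)
    then have "deriv h 0 = - of_nat (Suc m) * N a" by (rule DERIV_imp_deriv)
    ultimately show ?thesis by (simp add: norm_mult del: of_nat_Suc)
  qed
  have "cmod (N a) = 0"
    by (rule nonneg_eq_0_if_multiples_bounded[OF norm_ge_zero bound])
  then show ?thesis by simp
qed

text \<open>\<open>D\<close> is the sum of its complex-linear part \<open>L\<close> and the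
  conjugate of a complex-linear \<open>N\<close>. If \<open>L\<close> and \<open>N\<close> had equal
  modulus at an invertible \<open>x\<close>, then \<open>D\<close> would vanish at a nonzero
  multiple of \<open>x\<close>, although 0 is not in its spectrum. Hence
  \<open>dominated_functional_eq_0\<close> gives \<open>N = 0\<close>.\<close>

lemma real_linear_spectral_selection_imp_complex_linear:
  fixes D :: "'a::complex_banach_algebra \<Rightarrow> complex"
  assumes spec: "\<And>x. D x \<in> spectrum x"
    and add: "\<And>x y. D (x + y) = D x + D y" and real: "\<And>r x. D (r *\<^sub>R x) = of_real r * D x"
  shows "D (c *\<^sub>C x) = c * D x"
proof -
  interpret additive D by standard (rule add)
  have Dc: "D (c *\<^sub>C x) = of_real (Re c) * D x + of_real (Im c) * D (\<i> *\<^sub>C x)" for c x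
  proof -
    have "c *\<^sub>C x = complex_of_real (Re c) *\<^sub>C x + complex_of_real (Im c) *\<^sub>C \<i> *\<^sub>C x"
      by (simp add: scaleC_scaleC mult.commute flip: scaleC_add_left complex_eq)
    then show ?thesis by (simp only: add scaleC_of_real real)
  qed
  define L where "L x = (D x - \<i> * D (\<i> *\<^sub>C x)) / 2" for x
  define N where "N x = cnj ((D x + \<i> * D (\<i> *\<^sub>C x)) / 2)" for x
  have ii: "D ((\<i> * c) *\<^sub>C x) = of_real (- Im c) * D x + of_real (Re c) * D (\<i> *\<^sub>C x)" for c x
    using Dc[of "\<i> * c" x] by simp
  have cRI: "c = of_real (Re c) + \<i> * of_real (Im c)" "cnj c = of_real (Re c) - \<i> * of_real (Im c)" for c
    by (simp_all add: complex_eq_iff)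
  have L: "L (c *\<^sub>C x) = c * L x" for c x
    by (subst (3) cRI(1)) (simp add: L_def Dc[of c] ii algebra_simps add_divide_distrib diff_divide_distrib)
  have N': "(D (c *\<^sub>C x) + \<i> * D (\<i> *\<^sub>C c *\<^sub>C x)) / 2 = cnj c * ((D x + \<i> * D (\<i> *\<^sub>C x)) / 2)" for c x
    by (subst cRI(2)) (simp add: Dc[of c] ii algebra_simps add_divide_distrib diff_divide_distrib)
  have N: "N (c *\<^sub>C x) = c * N x" for c x
    unfolding N_def N' by simp
  have DLN: "D (c *\<^sub>C x) = c * L x + cnj c * cnj (N x)" for c x
    by (subst (2) cRI(1), subst cRI(2)) (simp add: L_def N_def Dc[of c] algebra_simps add_divide_distrib diff_divide_distrib)
  have D1: "D (c *\<^sub>C 1) = c" for c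
    using spec[of "c *\<^sub>C 1"] by (simp add: spectrum_scaleC_one)
  have "N x = 0" for x
  proof (rule dominated_functional_eq_0[where L=L])
    show "L (x - y) = L x - L y" "N (x - y) = N x - N y" for x y
      by (simp_all add: L_def N_def diff scaleC.scale_right_diff_distrib algebra_simps diff_divide_distrib add_divide_distrib)
    show "L 1 = 1" "N 1 = 0"
      using D1[of 1] D1[of \<i>] by (simp_all add: L_def N_def scaleC_one)
    fix x :: 'a assume inv: "invertible_elem x"
    show "cmod (L x) \<noteq> cmod (N x)"
    proof
      assume eq: "cmod (L x) = cmod (N x)"
      have "\<exists>c. c \<noteq> 0 \<and> c * L x + cnj c * cnj (N x) = 0"
      proof (cases "L x = 0")
        case True
        with eq show ?thesis by (intro exI[of _ 1]) auto
      next
        case False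
        \<comment> \<open>Since \<open>c\<close> has modulus 1, multiplying the desired equation by
          \<open>c\<close> turns it into \<open>c^2 L x + cnj (N x) = 0\<close>, which determines
          \<open>c^2\<close>.\<close>
        define c where "c = csqrt (- cnj (N x) / L x)"
        have "cmod (c\<^sup>2) = 1" using False by (simp add: c_def norm_divide flip: eq)
        then have "(cmod c)\<^sup>2 = 1\<^sup>2" by (simp add: norm_power)
        then have c1: "cmod c = 1" by (rule power2_eq_imp_eq) auto
        have "c * cnj c = 1" using c1 by (simp flip: complex_norm_square)
        moreover have "c * c = - cnj (N x) / L x" by (simp add: c_def flip: power2_eq_square)
        ultimately have "c * (c * L x + cnj c * cnj (N x)) = 0"
          using False by (simp add: distrib_left mult.assoc[symmetric])
        with c1 show ?thesis by (intro exI[of _ c]) auto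
      qed
      then obtain c where "c \<noteq> 0" "D (c *\<^sub>C x) = 0" unfolding DLN by blast
      then show False
        using spec[of "c *\<^sub>C x"] invertible_elem_scaleC[OF _ inv] by (simp add: spectrum_def)
    qed
  qed (fact L N)+
  then have "D (c *\<^sub>C x) = c * L x" for c x using DLN by simp
  from this[of c] this[of 1] show ?thesis by (simp add: scaleC_one)
qed

text \<open>
  The function \<open>t \<mapsto> L ((1 - t a)\<^sup>n)\<close> has a holomorphic \<open>n\<close>-th root \<open>r\<close> that is bounded independently of
  \<open>n\<close>, and \<open>r'' 0 = (n - 1) (L (a\<^sup>2) - (L a)\<^sup>2)\<close>.
\<close>

lemma spectral_functional_square:
  fixes L :: "'a::complex_banach_algebra \<Rightarrow> complex"
  assumes spec: "\<And>x. L x \<in> spectrum x"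
    and diff: "\<And>x y. L (x - y) = L x - L y" and scale: "\<And>c x. L (c *\<^sub>C x) = c * L x"
  shows "L (a * a) = L a * L a"
proof -
  define R where "R = 1 / (norm a + 1)"
  have R: "R > 0" using norm_ge_zero[of a] by (simp add: R_def add_nonneg_pos)
  define B where "B = norm (1::'a) + 1"
  have B: "B \<ge> 0" by (simp add: B_def)
  have L1: "L 1 = 1" using spec[of "1 *\<^sub>C 1"] unfolding spectrum_scaleC_one by (simp add: scaleC_one)
  have bound: "real (Suc m) * cmod (L (a * a) - L a * L a) \<le> 2 * B / (R / 2)\<^sup>2" for m
  proof -
    \<comment> \<open>With \<open>n = m + 2\<close> the factor \<open>n - 1\<close> in the second
      derivative of the root is \<open>Suc m\<close>.\<close>
    define n where "n = Suc (Suc m)"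
    define q where "q k x t = L (x * (1 - t *\<^sub>C a) ^ k)" for k x t
    have dq: "(q (Suc k) x has_field_derivative - of_nat (Suc k) * q k (x * a) t) (at t)" for k x t
      unfolding q_def by (intro has_field_derivative_functional_power diff scale)
    have q0: "q n 1 0 = 1" by (simp add: q_def L1)
    have hol: "q n 1 holomorphic_on ball 0 R"
      using dq by (auto simp: holomorphic_on_open n_def)
    have nz: "q n 1 t \<noteq> 0" if "t \<in> ball 0 R" for t
    proof -
      have "invertible_elem ((1 - t *\<^sub>C a) ^ n)"
        using that by (intro invertible_elem_one_minus_scaleC_power) (simp add: R_def)
      then show ?thesis
        using spec[of "(1 - t *\<^sub>C a) ^ n"] by (auto simp: spectrum_def q_def)
    qed
    obtain g where g: "g holomorphic_on ball 0 R" "\<And>t. t \<in> ball 0 R \<Longrightarrow> exp (g t) = q n 1 t"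
      by (rule holomorphic_logarithm_exists[OF _ _ hol nz, of 0]) (use R in auto)
    \<comment> \<open>The branch of the \<open>n\<close>-th root with value 1 at 0.\<close>
    define r where "r t = exp ((g t - g 0) / of_nat n)" for t
    have rn: "r t ^ n = q n 1 t" if "t \<in> ball 0 R" for t
    proof -
      have "r t ^ n = exp (of_nat n * ((g t - g 0) / of_nat n))"
        by (simp only: r_def exp_of_nat_mult)
      also have "\<dots> = exp (g t) / exp (g 0)" by (simp add: n_def exp_diff del: of_nat_Suc)
      finally show ?thesis using g(2)[OF that] g(2)[of 0] R q0 by simp
    qed
    have r0: "r 0 = 1" by (simp add: r_def)
    have holr: "r holomorphic_on ball 0 R"
      unfolding r_def using g(1) by (intro holomorphic_intros) (auto simp: n_def)
    have rB: "cmod (r t) \<le> B" if t: "t \<in> ball 0 R" for t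
    proof -
      have "norm (t *\<^sub>C a) \<le> R * norm a"
        using t unfolding norm_scaleC by (intro mult_right_mono) auto
      also have "\<dots> \<le> 1"
        unfolding R_def by (simp add: divide_le_eq_1_pos add_nonneg_pos)
      finally have P: "norm (1 - t *\<^sub>C a) \<le> B"
        unfolding B_def by (intro order_trans[OF norm_triangle_ineq4]) simp
      \<comment> \<open>Starting the induction at exponent 1 avoids the factor \<open>norm 1\<close>
        of \<open>norm_power_le\<close>.\<close>
      have pow: "norm ((1 - t *\<^sub>C a) ^ Suc k) \<le> norm (1 - t *\<^sub>C a) ^ Suc k" for k
      proof (induction k)
        case (Suc k)
        have "norm ((1 - t *\<^sub>C a) ^ Suc (Suc k)) \<le> norm (1 - t *\<^sub>C a) * norm ((1 - t *\<^sub>C a) ^ Suc k)"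
          unfolding power_Suc[of _ "Suc k"] by (rule norm_mult_ineq)
        also have "\<dots> \<le> norm (1 - t *\<^sub>C a) * norm (1 - t *\<^sub>C a) ^ Suc k"
          by (intro mult_left_mono Suc) simp
        finally show ?case by simp
      qed simp
      have "cmod (r t) ^ n = cmod (L ((1 - t *\<^sub>C a) ^ n))"
        using rn[OF t] by (simp add: q_def flip: norm_power)
      also have "\<dots> \<le> norm ((1 - t *\<^sub>C a) ^ n)" by (rule norm_spectrum_le[OF spec])
      also have "\<dots> \<le> norm (1 - t *\<^sub>C a) ^ n" unfolding n_def by (rule pow)
      also have "\<dots> \<le> B ^ n" using P by (intro power_mono) auto
      finally show ?thesis using B by (rule power_le_imp_le_base[of _ "Suc m" B, folded n_def])
    qed
    \<comment> \<open>The radius is halved because \<open>r\<close> is known to be holomorphic on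
      the open ball only.\<close>
    have cauchy: "cmod ((deriv ^^ 2) r 0) \<le> fact 2 * B / (R / 2) ^ 2"
      using R by (intro Cauchy_inequality holomorphic_on_subset[OF holr]
          continuous_on_subset[OF holomorphic_on_imp_continuous_on[OF holr]] rB) auto
    have dr: "(r has_field_derivative deriv r t) (at t)" if "t \<in> ball 0 R" for t
      using holomorphic_derivI[OF holr _ that] by simp
    have drr: "(deriv r has_field_derivative deriv (deriv r) 0) (at 0)"
      using R by (intro holomorphic_derivI[OF holomorphic_deriv[OF holr]]) auto
    have first: "of_nat n * (r t ^ Suc m * deriv r t) = - of_nat n * q (Suc m) a t" if t: "t \<in> ball 0 R" for t
    proof -
      have "((\<lambda>t. r t ^ n) has_field_derivative of_nat n * (deriv r t * r t ^ (n - Suc 0))) (at t)"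
        by (intro DERIV_power dr t)
      then have "(q n 1 has_field_derivative of_nat n * (deriv r t * r t ^ (n - Suc 0))) (at t)"
        by (rule has_field_derivative_transform_within_open[where S="ball 0 R"]) (use t rn in auto)
      moreover have "(q n 1 has_field_derivative - of_nat n * q (Suc m) a t) (at t)"
        using dq[of "Suc m" 1 t] by (simp add: n_def del: of_nat_Suc)
      ultimately show ?thesis using DERIV_unique by (fastforce simp: n_def mult.commute)
    qed
    have first': "r t ^ Suc m * deriv r t = - q (Suc m) a t" if "t \<in> ball 0 R" for t
    proof -
      have "complex_of_nat n * (r t ^ Suc m * deriv r t) = of_nat n * - q (Suc m) a t"
        using first[OF that] by simp
      moreover have "complex_of_nat n \<noteq> 0" by (simp add: n_def del: of_nat_Suc)
      ultimately show ?thesis using mult_left_cancel by blast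
    qed
    have dr0: "deriv r 0 = - L a"
      using first'[of 0] R r0 by (simp add: q_def)
    \<comment> \<open>Both sides of \<open>first'\<close> are differentiated at 0, which determines
      the second derivative of \<open>r\<close> there.\<close>
    have "((\<lambda>t. r t ^ Suc m * deriv r t) has_field_derivative
        of_nat (Suc m) * (deriv r 0 * r 0 ^ (Suc m - Suc 0)) * deriv r 0 + deriv (deriv r) 0 * r 0 ^ Suc m) (at 0)"
      by (intro DERIV_mult DERIV_power drr dr) (use R in auto)
    then have "((\<lambda>t. - q (Suc m) a t) has_field_derivative
        of_nat (Suc m) * (deriv r 0 * r 0 ^ (Suc m - Suc 0)) * deriv r 0 + deriv (deriv r) 0 * r 0 ^ Suc m) (at 0)"
      by (rule has_field_derivative_transform_within_open[where S="ball 0 R"]) (use R first' in auto)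
    moreover have "((\<lambda>t. - q (Suc m) a t) has_field_derivative - (- of_nat (Suc m) * q m (a * a) 0)) (at 0)"
      by (intro DERIV_minus dq)
    ultimately have "of_nat (Suc m) * (deriv r 0 * r 0 ^ (Suc m - Suc 0)) * deriv r 0 + deriv (deriv r) 0 * r 0 ^ Suc m
       = - (- of_nat (Suc m) * q m (a * a) 0)"
      by (rule DERIV_unique)
    then have "deriv (deriv r) 0 = of_nat (Suc m) * (L (a * a) - L a * L a)"
      by (simp add: r0 dr0 q_def algebra_simps)
    with cauchy show ?thesis
      by (simp add: numeral_2_eq_2 norm_mult del: of_nat_Suc)
  qed
  have "cmod (L (a * a) - L a * L a) = 0"
    by (rule nonneg_eq_0_if_multiples_bounded[OF norm_ge_zero bound])
  then show ?thesis by simp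
qed

text \<open>Polarising squares yields the Jordan identity. This makes the kernel an ideal, and
  \<open>x - L x\<close> lies in the kernel.\<close>

lemma square_preserving_imp_multiplicative:
  fixes L :: "'a::complex_banach_algebra \<Rightarrow> complex"
  assumes add: "\<And>x y. L (x + y) = L x + L y" and scale: "\<And>c x. L (c *\<^sub>C x) = c * L x"
    and one: "L 1 = 1" and sq: "\<And>x. L (x * x) = L x * L x"
  shows "L (x * y) = L x * L y"
proof -
  interpret additive L by standard (rule add)
  have jordan: "L (x * y) + L (y * x) = 2 * L x * L y" for x y
    using sq[of "x + y"] by (simp add: algebra_simps add sq)
  have ker: "L (x * y) = 0" if x: "L x = 0" for x y
  proof -
    have sum0: "L (x * y) + L (y * x) = 0" using jordan[of x y] x by simp
    \<comment> \<open>The sum of the two squares is \<open>2 (x z + z x)\<close> with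
      \<open>z = y x y\<close>, to which the Jordan identity applies.\<close>
    have "L ((x * y - y * x) * (x * y - y * x)) + L ((x * y + y * x) * (x * y + y * x))
        = 2 * (L (x * (y * x * y)) + L (y * x * y * x))"
      by (simp add: algebra_simps add diff)
    also have "\<dots> = 0" using jordan[of x "y * x * y"] x by simp
    finally have "L (x * y - y * x) * L (x * y - y * x) = 0"
      using sum0 by (simp add: sq add)
    then have "L (x * y) = L (y * x)" by (simp add: diff)
    with sum0 show ?thesis by simp
  qed
  have "L ((x - L x *\<^sub>C 1) * y) = 0"
    by (rule ker) (simp add: diff scale one)
  then show ?thesis by (simp add: left_diff_distrib mult_scaleC_left diff scale)
qed

subsection \<open>The theorem of Kowalski and Slodkowski\<close>

text \<open>The maximum of the flux is attained at a complex-linear \<open>D\<close>, where it is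
  \<open>Re (\<omega> d c D v - \<omega> c d D v) = 0\<close>. Hence
  \<open>Re (\<omega> X) \<le> 0\<close> for all \<omega>, and \<omega> = \<open>cnj X\<close>
  forces \<open>X = 0\<close>.\<close>

lemma spectral_selection_parallelogram:
  fixes f :: "'a::complex_banach_algebra \<Rightarrow> complex"
  assumes f: "f \<in> spectral_selections"
  shows "d * slab (c *\<^sub>C v) (d *\<^sub>C v) f = c * slab (d *\<^sub>C v) (c *\<^sub>C v) f"
proof -
  define X where "X = d * slab (c *\<^sub>C v) (d *\<^sub>C v) f - c * slab (d *\<^sub>C v) (c *\<^sub>C v) f"
  have "Re (\<omega> * X) \<le> 0" for \<omega>
  proof -
    obtain D where D: "D \<in> spectral_selections" "\<And>x y. D (x + y) = D x + D y"
      "\<And>r x. D (r *\<^sub>R x) = of_real r * D x"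
      and max: "\<And>f. f \<in> spectral_selections \<Longrightarrow> flux (\<omega> * d) (- \<omega> * c) (c *\<^sub>C v) (d *\<^sub>C v) f
        \<le> Re (\<omega> * d * D (c *\<^sub>C v) + - \<omega> * c * D (d *\<^sub>C v))"
      using exists_linear_maximizer[OF closed_spectral_selections _ renormalizable_spectral_selections
          spectral_selections_subset, of "\<omega> * d" "- \<omega> * c" "c *\<^sub>C v" "d *\<^sub>C v"] f by blast
    have "D (b *\<^sub>C x) = b * D x" for b x
      by (rule real_linear_spectral_selection_imp_complex_linear[OF spectral_selectionsD(3)[OF D(1)] D(2,3)])
    then show ?thesis
      using max[OF f] by (simp only: flux_def X_def) (simp add: algebra_simps)
  qed
  from this[of "cnj X"] have "X = 0" 
    by (simp add: mult.commute[of "cnj X"] complex_mult_cnj sum_power2_le_zero_iff complex_eq_iff)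
  then show ?thesis by (simp add: X_def)
qed

text \<open>Applying the parallelogram identity to the shifts of \<open>f\<close> along the line
  moves the base point, so \<open>h\<close> satisfies the hypothesis of the Morera argument on all
  parallelograms.\<close>

lemma spectral_selection_affine_on_lines:
  fixes f :: "'a::complex_banach_algebra \<Rightarrow> complex"
  assumes f: "f \<in> spectral_selections"
  shows "\<exists>k. \<forall>z. f (x + z *\<^sub>C v) = f x + z * k"
proof -
  define h where "h z = f (x + z *\<^sub>C v)" for z
  have lip: "(norm v)-lipschitz_on UNIV h"
  proof (rule lipschitz_onI)
    fix z w
    have "dist (h z) (h w) \<le> norm ((z - w) *\<^sub>C v)"
      using norm_spectrum_le[OF spectral_selectionsD(2)[OF f], of "x + z *\<^sub>C v" "x + w *\<^sub>C v"]
      by (simp add: h_def dist_norm scaleC.scale_left_diff_distrib)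
    then show "dist (h z) (h w) \<le> norm v * dist z w"
      by (simp only: norm_scaleC dist_norm mult.commute)
  qed simp
  have cont: "continuous_on S h" for S
    using lipschitz_on_continuous_on[OF lip] continuous_on_subset by blast
  have line: "contour_integral (linepath a (a + d)) h = d * integral {0..1} (\<lambda>s. h (a + of_real s * d))" for a d
  proof -
    have "contour_integral (linepath a (a + d)) h = integral {0..1} (\<lambda>s. h (linepath a (a + d) s) * d)"
      by (simp add: contour_integral_integral)
    also have "(\<lambda>s. h (linepath a (a + d) s) * d) = (\<lambda>s. d * h (a + of_real s * d))"
      by (rule ext) (simp add: linepath_def scaleR_conv_of_real algebra_simps)
    finally show ?thesis by simp
  qed
  have slab_eq: "d * slab (c *\<^sub>C v) (d *\<^sub>C v) (shift (x + a *\<^sub>C v) f)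
      = contour_integral (linepath (a + c) (a + c + d)) h - contour_integral (linepath a (a + d)) h" for a c d
  proof -
    have int: "(\<lambda>s. h (b + of_real s * d)) integrable_on {0..1}" for b
      by (intro integrable_continuous_interval continuous_on_compose2[OF cont[of UNIV]] continuous_intros) auto
    have pt: "shift (x + a *\<^sub>C v) f (b *\<^sub>C v + s *\<^sub>R d *\<^sub>C v) = h (a + b + of_real s * d) - f (x + a *\<^sub>C v)" for b s
    proof -
      have "x + a *\<^sub>C v + (b *\<^sub>C v + s *\<^sub>R d *\<^sub>C v) = x + (a + b + of_real s * d) *\<^sub>C v"
        by (simp only: scaleC_of_real[symmetric] scaleC_scaleC scaleC_add_left add.assoc)
      then show ?thesis by (simp only: shift_def h_def)
    qed
    have "slab (c *\<^sub>C v) (d *\<^sub>C v) (shift (x + a *\<^sub>C v) f)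
        = integral {0..1} (\<lambda>s. h (a + c + of_real s * d) - h (a + of_real s * d))"
      unfolding slab_def using pt[of c] pt[of 0] by simp
    also have "\<dots> = integral {0..1} (\<lambda>s. h (a + c + of_real s * d)) - integral {0..1} (\<lambda>s. h (a + of_real s * d))"
      by (intro integral_diff int)
    finally show ?thesis by (simp add: line right_diff_distrib)
  qed
  have "h z = h 0 + z * deriv h 0" for z
  proof (rule lipschitz_parallelogram_imp_affine[OF lip])
    fix a c d
    have "shift (x + a *\<^sub>C v) f \<in> spectral_selections"
      using renormalizableD(1)[OF renormalizable_spectral_selections f] .
    from spectral_selection_parallelogram[OF this, of d c v]
    show "contour_integral (linepath a (a + c)) h + contour_integral (linepath (a + c) (a + c + d)) h
      = contour_integral (linepath a (a + d)) h + contour_integral (linepath (a + d) (a + c + d)) h"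
      unfolding slab_eq by (simp add: algebra_simps)
  qed
  then show ?thesis by (intro exI[of _ "deriv h 0"]) (auto simp: h_def)
qed

text \<open>The slope of \<open>f\<close> in direction \<open>y\<close> is \<open>k\<close> on the
  line through \<open>x\<close> and, by homogeneity, \<open>f y\<close> on the line through 0. The
  two lines stay at bounded distance, so the slopes agree.\<close>

lemma homogeneous_spectral_selection_additive:
  fixes f :: "'a::complex_banach_algebra \<Rightarrow> complex"
  assumes f: "f \<in> spectral_selections" and hom: "\<And>c x. f (c *\<^sub>C x) = c * f x"
  shows "f (x + y) = f x + f y"
proof -
  obtain k where k: "\<And>z. f (x + z *\<^sub>C y) = f x + z * k"
    using spectral_selection_affine_on_lines[OF f, of x y] by auto
  have bound: "real n * cmod (k - f y) \<le> 2 * norm x" for n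
  proof -
    have "of_nat n * (k - f y) = (f (x + of_nat n *\<^sub>C y) - f (of_nat n *\<^sub>C y)) - f x"
      by (simp add: k hom algebra_simps)
    then have "real n * cmod (k - f y) = cmod ((f (x + of_nat n *\<^sub>C y) - f (of_nat n *\<^sub>C y)) - f x)"
      by (metis norm_mult norm_of_nat)
    also have "\<dots> \<le> norm x + norm x"
      using norm_spectrum_le[OF spectral_selectionsD(2)[OF f], of "x + of_nat n *\<^sub>C y" "of_nat n *\<^sub>C y"]
        norm_spectrum_le[OF spectral_selectionsD(3)[OF f], of x]
      by (intro order_trans[OF norm_triangle_ineq4 add_mono]) simp_all
    finally show ?thesis by simp
  qed
  have "cmod (k - f y) = 0"
    by (rule nonneg_eq_0_if_multiples_bounded[OF norm_ge_zero bound])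
  then have "k = f y" by simp
  then show ?thesis using k[of 1] by (simp add: scaleC_one)
qed

section \<open>Removing the circle from the spectral condition\<close>

lemma complex_collinear_of_norms:
  fixes u w :: complex
  assumes "cmod u = a" "cmod w = t * a" "cmod (w - u) = (t - 1) * a" "t \<ge> 1"
  shows "w = of_real t * u"
proof -
  \<comment> \<open>Equality in the triangle inequality makes \<open>u\<close> and
    \<open>w - u\<close> point in the same direction.\<close>
  have "cmod (u + (w - u)) = cmod u + cmod (w - u)" using assms by (simp add: algebra_simps)
  then have "cmod u *\<^sub>R (w - u) = cmod (w - u) *\<^sub>R u"
    by (rule norm_triangle_eq[THEN iffD1])
  then have "complex_of_real a * (w - u) = complex_of_real a * ((of_real t - 1) * u)"
    by (simp add: assms(1,3) scaleR_conv_of_real mult_ac)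
  moreover have "w = of_real t * u" if "a = 0"
  proof -
    have "u = 0" "w = 0" using assms(1,2) that by simp_all
    then show ?thesis by simp
  qed
  ultimately show ?thesis by (cases "a = 0") (simp_all add: left_diff_distrib)
qed

text \<open>
  Along \<open>\<lambda> \<mapsto> x + \<lambda> 1\<close> the spectral condition is an isometry condition, and an isometry at
  bounded distance from the identity is a translation.
\<close>

lemma homogeneous_translation:
  fixes f :: "'a::complex_banach_algebra \<Rightarrow> complex"
  assumes hom: "\<And>c x. f (c *\<^sub>C x) = c * f x" and one: "f 1 = 1"
    and spec: "\<And>x y. f x - f y \<in> circle_spectrum (x - y)"
  shows "f (x + c *\<^sub>C 1) = f x + c"
proof -
  define h where "h c = f (x + c *\<^sub>C 1) - f x" for c
  have isom: "cmod (h c - h d) = cmod (c - d)" for c d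
  proof -
    have "h c - h d \<in> circle_spectrum ((c - d) *\<^sub>C (1::'a))"
      using spec[of "x + c *\<^sub>C 1" "x + d *\<^sub>C 1"] by (simp add: h_def scaleC.scale_left_diff_distrib)
    then show ?thesis
      by (auto simp: circle_spectrum_def unit_circle_def spectrum_scaleC_one norm_mult)
  qed
  have near: "cmod (h c - c) \<le> 2 * norm x" for c
  proof -
    have le: "cmod (f y - f z) \<le> norm (y - z)" for y z
      using spec[of y z] norm_spectrum_le
      by (auto simp: circle_spectrum_def unit_circle_def norm_mult)
    have "h c - c = (f (x + c *\<^sub>C 1) - f (c *\<^sub>C 1)) - (f x - f 0)"
      using hom[of 0 0] by (simp add: h_def hom one)
    also have "cmod \<dots> \<le> norm x + norm x"
      using le[of "x + c *\<^sub>C 1" "c *\<^sub>C 1"] le[of x 0]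
      by (intro order_trans[OF norm_triangle_ineq4 add_mono]) simp_all
    finally show ?thesis by simp
  qed
  have h0: "h 0 = 0" by (simp add: h_def)
  \<comment> \<open>The images of 0, \<open>c\<close> and \<open>(n + 1) c\<close> realise equality
    in the triangle inequality, so \<open>h\<close> scales along rays and a nonzero
    \<open>h c - c\<close> would grow linearly.\<close>
  have ray: "h (of_nat (Suc n) * c) = of_nat (Suc n) * h c" for n c
  proof -
    have "h (of_nat (Suc n) * c) = of_real (real (Suc n)) * h c"
    proof (rule complex_collinear_of_norms[where a="cmod c"])
      show "cmod (h c) = cmod c" using isom[of c 0] h0 by simp
      show "cmod (h (of_nat (Suc n) * c)) = real (Suc n) * cmod c"
        using isom[of "of_nat (Suc n) * c" 0] h0 by (simp add: norm_mult del: of_nat_Suc)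
      have "of_nat (Suc n) * c - c = of_nat n * c" by (simp add: algebra_simps)
      then show "cmod (h (of_nat (Suc n) * c) - h c) = (real (Suc n) - 1) * cmod c"
        by (simp add: isom norm_mult)
    qed simp
    then show ?thesis by simp
  qed
  have bound: "real (Suc n) * cmod (h c - c) \<le> 2 * norm x" for n
  proof -
    have "of_nat (Suc n) * (h c - c) = h (of_nat (Suc n) * c) - of_nat (Suc n) * c"
      by (simp only: ray right_diff_distrib)
    then show ?thesis using near[of "of_nat (Suc n) * c"] by (metis norm_mult norm_of_nat)
  qed
  have "cmod (h c - c) = 0"
    by (rule nonneg_eq_0_if_multiples_bounded[OF norm_ge_zero bound])
  then have "h c = c" by simp
  then show ?thesis by (simp add: h_def algebra_simps)
qed

text \<open>Translating \<open>x\<close> by \<open>- d 1\<close> makes the difference of values 0. A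
  unimodular multiple of a spectral value vanishes only if that value does, so 0 is in the spectrum
  of \<open>x - y - d 1\<close>.\<close>

lemma homogeneous_circle_spectral_imp_spectral_selection:
  fixes f :: "'a::complex_banach_algebra \<Rightarrow> complex"
  assumes hom: "\<And>c x. f (c *\<^sub>C x) = c * f x" and one: "f 1 = 1"
    and spec: "\<And>x y. f x - f y \<in> circle_spectrum (x - y)"
  shows "f \<in> spectral_selections"
proof -
  have "f x - f y \<in> spectrum (x - y)" for x y
  proof -
    define d where "d = f x - f y"
    have "f (x + (- d) *\<^sub>C 1) - f y = 0"
      unfolding homogeneous_translation[OF hom one spec] by (simp add: d_def)
    with spec[of "x + (- d) *\<^sub>C 1" y] have "0 \<in> spectrum (x + (- d) *\<^sub>C 1 - y)"
      by (auto simp: circle_spectrum_def unit_circle_def)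
    then show ?thesis by (simp add: spectrum_def d_def[symmetric] algebra_simps)
  qed
  then show ?thesis using hom[of 0 0] by (simp add: spectral_selections_def)
qed

theorem proposition3p2:
  fixes \<Delta> :: "'a::complex_banach_algebra \<Rightarrow> complex"
  assumes homogeneous: "\<And>c x. \<Delta> (c *\<^sub>C x) = c * \<Delta> x"
    and spectral: "\<And>x y. \<Delta> x - \<Delta> y \<in> circle_spectrum (x - y)"
  shows "Vector_Spaces.linear (scaleC :: complex \<Rightarrow> 'a \<Rightarrow> 'a) ((*) :: complex \<Rightarrow> complex \<Rightarrow> complex) \<Delta> \<and>
    (\<exists>\<zeta>\<in>unit_circle. \<forall>x y. \<zeta> * \<Delta> (x * y) = (\<zeta> * \<Delta> x) * (\<zeta> * \<Delta> y))"
proof -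
  have "\<Delta> 1 \<in> circle_spectrum (1 *\<^sub>C (1::'a))"
    using spectral[of 1 0] homogeneous[of 0 0] by (simp add: scaleC_one)
  then have norm1: "cmod (\<Delta> 1) = 1"
    by (auto simp: circle_spectrum_def unit_circle_def spectrum_scaleC_one norm_mult simp del: scaleC.scale_one)
  \<comment> \<open>Unimodular because the spectrum of the unit is \<open>{1}\<close>. It normalises
    \<open>f 1 = 1\<close>, and multiplying by it maps \<open>circle_spectrum\<close> into
    itself.\<close>
  define \<zeta> where "\<zeta> = 1 / \<Delta> 1"
  have \<zeta>: "\<zeta> \<in> unit_circle" "\<zeta> \<noteq> 0" using norm1 by (auto simp: \<zeta>_def unit_circle_def norm_divide)
  define f where "f x = \<zeta> * \<Delta> x" for x
  have hom: "f (c *\<^sub>C x) = c * f x" for c x by (simp add: f_def homogeneous)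
  have one: "f 1 = 1" using norm1 by (auto simp: f_def \<zeta>_def)
  have spec: "f x - f y \<in> circle_spectrum (x - y)" for x y
  proof -
    obtain \<eta> \<mu> where "\<eta> \<in> unit_circle" "\<mu> \<in> spectrum (x - y)" "\<Delta> x - \<Delta> y = \<eta> * \<mu>"
      using spectral[of x y] by (auto simp: circle_spectrum_def)
    moreover from this have "f x - f y = (\<zeta> * \<eta>) * \<mu>" by (simp add: f_def flip: right_diff_distrib)
    moreover have "\<zeta> * \<eta> \<in> unit_circle"
      using \<zeta>(1) \<open>\<eta> \<in> unit_circle\<close> by (simp add: unit_circle_def norm_mult)
    ultimately show ?thesis unfolding circle_spectrum_def by blast
  qed
  have sel: "f \<in> spectral_selections"
    by (rule homogeneous_circle_spectral_imp_spectral_selection[OF hom one spec])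
  have add: "f (x + y) = f x + f y" for x y
    by (rule homogeneous_spectral_selection_additive[OF sel hom])
  interpret additive f by standard (rule add)
  have "f (x * x) = f x * f x" for x
    by (rule spectral_functional_square[OF spectral_selectionsD(3)[OF sel] diff hom])
  then have mult: "f (x * y) = f x * f y" for x y
    by (rule square_preserving_imp_multiplicative[OF add hom one])
  have "\<Delta> (x + y) = \<Delta> x + \<Delta> y" for x y
    using add[of x y] \<zeta>(2) by (simp add: f_def flip: distrib_left)
  then have "Vector_Spaces.linear (scaleC :: complex \<Rightarrow> 'a \<Rightarrow> 'a) (*) \<Delta>"
    by unfold_locales (simp_all add: homogeneous algebra_simps)
  moreover have "\<forall>x y. \<zeta> * \<Delta> (x * y) = (\<zeta> * \<Delta> x) * (\<zeta> * \<Delta> y)"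
    using mult unfolding f_def by blast
  ultimately show ?thesis using \<zeta>(1) by blast
qed

end
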